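(* Fix $\theta\in(-\frac{\pi}{2},\frac{\pi}{2})$. The semigroup $\{T_t^2\}_{t\ge0}$ defined below is a semigroup of normal operators in $L^2(\gamma)$, and consequently its infinitesimal generator $\mathcal{A}_2$ is a normal operator in $L^2(\gamma)$.
   Context: Identify $\mathbb{R}^2$ with $\mathbb{C}$ via $(y_1,y_2)\mapsto y_1+\mathrm{i}y_2$. Let $d\gamma(y)=\frac{1}{2\pi}e^{-(y_1^2+y_2^2)/2}\,dy_1\,dy_2$ and $L^p(\gamma)$ the corresponding complex $L^p$ spaces. For $\varphi\in C_b(\mathbb{R}^2)$ (bounded continuous complex functions), $t\ge0$, $x\in\mathbb{C}$, let $$P_t\varphi(x)=\int_{\mathbb{C}}\varphi\big(e^{-(\cos\theta+\mathrm{i}\sin\theta)t}x+\sqrt{1-e^{-2t\cos\theta}}\,y\big)\,d\gamma(y).$$ For each $p\ge1$, $\|P_t\varphi\|_{L^p(\gamma)}\le\|\varphi\|_{L^p(\gamma)}$, and $\{P_t\}$ extends uniquely (by closure) to a strongly continuous contraction semigroup $\{T_t^p\}_{t\ge0}$ on $L^p(\gamma)$; $\mathcal{A}_p$ denotes its infinitesimal generator. An (unbounded, densely defined, closed) operator $N$ is normal if $D(N)=D(N^* )$ and $\|Nf\|=\|N^*f\|$ for $f\in D(N)$ (equivalently $NN^*=N^*N$). *)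

theory Defs
  imports "HOL-Analysis.Analysis"
begin

definition gauss :: "complex measure" where
  "gauss = density lborel (\<lambda>z. ennreal (exp (- ((cmod z)^2) / 2) / (2 * pi)))"

text \<open>Square integrable (representatives of elements of) L^2(gamma).\<close>
definition L2 :: "(complex \<Rightarrow> complex) \<Rightarrow> bool" where
  "L2 f \<longleftrightarrow> f \<in> borel_measurable gauss \<and> integrable gauss (\<lambda>x. (cmod (f x))^2)"

definition L2norm :: "(complex \<Rightarrow> complex) \<Rightarrow> real" where
  "L2norm f = sqrt (integral\<^sup>L gauss (\<lambda>x. (cmod (f x))^2))"

definition L2inner :: "(complex \<Rightarrow> complex) \<Rightarrow> (complex \<Rightarrow> complex) \<Rightarrow> complex" where
  "L2inner f g = integral\<^sup>L gauss (\<lambda>x. f x * cnj (g x))"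

definition Cb :: "(complex \<Rightarrow> complex) \<Rightarrow> bool" where
  "Cb \<phi> \<longleftrightarrow> continuous_on UNIV \<phi> \<and> bounded (range \<phi>)"

definition Pt :: "real \<Rightarrow> real \<Rightarrow> (complex \<Rightarrow> complex) \<Rightarrow> complex \<Rightarrow> complex" where
  "Pt \<theta> t \<phi> x = integral\<^sup>L gauss (\<lambda>y. \<phi> (exp (- cis \<theta> * complex_of_real t) * x
        + complex_of_real (sqrt (1 - exp (-2 * t * cos \<theta>))) * y))"

text \<open>The closure of P_t in L^2: g represents T_t f iff there are bounded continuous
  phi_n with phi_n \<rightarrow> f and P_t phi_n \<rightarrow> g in L^2(gamma).\<close>
definition Trel :: "real \<Rightarrow> real \<Rightarrow> (complex \<Rightarrow> complex) \<Rightarrow> (complex \<Rightarrow> complex) \<Rightarrow> bool" where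
  "Trel \<theta> t f g \<longleftrightarrow> (\<exists>\<phi> :: nat \<Rightarrow> complex \<Rightarrow> complex. (\<forall>n. Cb (\<phi> n)) \<and>
      (\<lambda>n. L2norm (\<lambda>x. \<phi> n x - f x)) \<longlonglongrightarrow> 0 \<and>
      (\<lambda>n. L2norm (\<lambda>x. Pt \<theta> t (\<phi> n) x - g x)) \<longlonglongrightarrow> 0)"

definition T2 :: "real \<Rightarrow> real \<Rightarrow> (complex \<Rightarrow> complex) \<Rightarrow> complex \<Rightarrow> complex" where
  "T2 \<theta> t f = (SOME g. L2 g \<and> Trel \<theta> t f g)"

definition gen_lim :: "real \<Rightarrow> (complex \<Rightarrow> complex) \<Rightarrow> (complex \<Rightarrow> complex) \<Rightarrow> bool" where
  "gen_lim \<theta> f h \<longleftrightarrow> L2 h \<and>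
     ((\<lambda>s. L2norm (\<lambda>x. (T2 \<theta> s f x - f x) / complex_of_real s - h x)) \<longlongrightarrow> 0) (at_right 0)"

definition gen_dom :: "real \<Rightarrow> (complex \<Rightarrow> complex) set" where
  "gen_dom \<theta> = {f. L2 f \<and> (\<exists>h. gen_lim \<theta> f h)}"

definition gen :: "real \<Rightarrow> (complex \<Rightarrow> complex) \<Rightarrow> complex \<Rightarrow> complex" where
  "gen \<theta> f = (SOME h. gen_lim \<theta> f h)"

definition adj_dom :: "(complex \<Rightarrow> complex) set \<Rightarrow> ((complex \<Rightarrow> complex) \<Rightarrow> complex \<Rightarrow> complex)
    \<Rightarrow> (complex \<Rightarrow> complex) set" where
  "adj_dom D N = {g. L2 g \<and> (\<exists>h. L2 h \<and> (\<forall>f\<in>D. L2inner (N f) g = L2inner f h))}"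

definition adj :: "(complex \<Rightarrow> complex) set \<Rightarrow> ((complex \<Rightarrow> complex) \<Rightarrow> complex \<Rightarrow> complex)
    \<Rightarrow> (complex \<Rightarrow> complex) \<Rightarrow> complex \<Rightarrow> complex" where
  "adj D N g = (SOME h. L2 h \<and> (\<forall>f\<in>D. L2inner (N f) g = L2inner f h))"

definition normal_op :: "(complex \<Rightarrow> complex) set \<Rightarrow> ((complex \<Rightarrow> complex) \<Rightarrow> complex \<Rightarrow> complex) \<Rightarrow> bool" where
  "normal_op D N \<longleftrightarrow>
     D \<subseteq> {f. L2 f} \<and> (\<forall>f\<in>D. L2 (N f)) \<and>
     (\<forall>f. L2 f \<longrightarrow> (\<forall>e>0. \<exists>g\<in>D. L2norm (\<lambda>x. f x - g x) < e)) \<and>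
     (\<forall>fs f h. (\<forall>n. fs n \<in> D) \<and> L2 f \<and> L2 h \<and>
         (\<lambda>n. L2norm (\<lambda>x. fs n x - f x)) \<longlonglongrightarrow> 0 \<and>
         (\<lambda>n. L2norm (\<lambda>x. N (fs n) x - h x)) \<longlonglongrightarrow> 0
       \<longrightarrow> f \<in> D \<and> L2norm (\<lambda>x. N f x - h x) = 0) \<and>
     adj_dom D N = D \<and>
     (\<forall>f\<in>D. L2norm (N f) = L2norm (adj D N f))"

end

theory Submission
  imports Defs "HOL-Probability.Probability"
begin

text \<open>
  Write \<open>Q a f x = \<integral> f (a x + sqrt (1 - |a|\<^sup>2) y) d\<gamma>(y)\<close>, so that \<open>P\<^sub>t = Q (exp (- t e\<^sup>i\<^sup>\<theta>))\<close>.
  Since \<open>(x, y) \<mapsto> (a x + s y, s x - cnj a y)\<close> with \<open>s = sqrt (1 - |a|\<^sup>2)\<close> is unitary, it preserves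
  \<open>\<gamma> \<otimes> \<gamma>\<close>. Hence \<open>Q a\<close> is a contraction of \<open>L\<^sup>2(\<gamma>)\<close> with adjoint \<open>Q (cnj a)\<close>, and
  \<open>Q a Q b = Q (a b)\<close>; in particular every \<open>Q a\<close> is normal and all of them commute.

  For the generator \<open>A\<close> of a contraction semigroup \<open>T\<close> that commutes with its adjoint semigroup \<open>S\<close>:
  the operator \<open>(T s - I)/s - (T r - I)/r\<close> is normal, so the difference quotients of \<open>T\<close> and \<open>S\<close>
  at a vector converge simultaneously and to limits of equal norm. The generator of \<open>S\<close> is the
  adjoint of \<open>A\<close> because \<open>A\<close> maps \<open>\<integral>\<^sub>0\<^sup>t T s x ds\<close> to \<open>T t x - x\<close>.
\<close>

section \<open>Generators of commuting adjoint semigroups\<close>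

text \<open>The definitions work with functions, and \<open>T2\<close>, \<open>gen\<close> and
  \<open>adj\<close> choose values by \<open>SOME\<close>, which are determined at best up to null
  sets. The analysis therefore takes place in the quotient \<open>l2\<close>, and its results are
  carried back to functions at the end. \<open>l2\<close> is a real Hilbert space with the real part
  of \<open>L2inner\<close> as inner product. Nothing is lost by this, because the operators
  concerned commute with multiplication by the imaginary unit, and real adjoints of such operators
  are complex adjoints. Simultaneous convergence of the difference quotients shows that both
  generators have the same domain. The delicate half of normality is that the adjoint of A is no
  proper extension of the generator of S.\<close>

lemma norm_eq_of_commuting_adjoint:
  fixes X Y :: "'a::real_inner \<Rightarrow> 'a"
  assumes adj: "\<And>x y. inner (X x) y = inner x (Y y)"
    and comm: "\<And>x. X (Y x) = Y (X x)"
  shows "norm (X x) = norm (Y x)"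
proof -
  have "inner (X x) (X x) = inner x (X (Y x))"
    by (simp add: adj comm)
  also have "\<dots> = inner (Y x) (Y x)"
    by (metis adj inner_commute)
  finally show ?thesis
    by (simp add: norm_eq_sqrt_inner)
qed

text \<open>Normality of the single operators is \<open>commute\<close> at equal times. The mixed
  form is assumed because difference quotients at two different times are subtracted from each
  other.\<close>

locale adjoint_semigroups =
  fixes T S :: "real \<Rightarrow> 'a::{real_inner,banach} \<Rightarrow> 'a"
  assumes linear_T: "t \<ge> 0 \<Longrightarrow> linear (T t)"
    and linear_S: "t \<ge> 0 \<Longrightarrow> linear (S t)"
    and contraction_T: "t \<ge> 0 \<Longrightarrow> norm (T t x) \<le> norm x"
    and contraction_S: "t \<ge> 0 \<Longrightarrow> norm (S t x) \<le> norm x"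
    and T_0: "T 0 x = x"
    and S_0: "S 0 x = x"
    and T_add: "s \<ge> 0 \<Longrightarrow> t \<ge> 0 \<Longrightarrow> T (s + t) x = T s (T t x)"
    and S_add: "s \<ge> 0 \<Longrightarrow> t \<ge> 0 \<Longrightarrow> S (s + t) x = S s (S t x)"
    and tendsto_T: "((\<lambda>t. T t x) \<longlongrightarrow> x) (at_right 0)"
    and tendsto_S: "((\<lambda>t. S t x) \<longlongrightarrow> x) (at_right 0)"
    and adjoint: "t \<ge> 0 \<Longrightarrow> inner (T t x) y = inner x (S t y)"
    and commute: "s \<ge> 0 \<Longrightarrow> t \<ge> 0 \<Longrightarrow> T s (S t x) = S t (T s x)"
begin

text \<open>The assumptions keep their form when \<open>T\<close> and \<open>S\<close> trade places,
  so each fact about \<open>T\<close> is available for \<open>S\<close> through an interpretation of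
  the locale.\<close>

lemma swap: "adjoint_semigroups S T"
proof (rule adjoint_semigroups.intro)
  show "inner (S t x) y = inner x (T t y)" if "t \<ge> 0" for t x y
    using adjoint[OF that, of y x] by (simp add: inner_commute)
qed (use linear_T linear_S contraction_T contraction_S T_0 S_0 T_add S_add tendsto_T tendsto_S
     commute in auto)

text \<open>The generator is kept as a graph, so that domain and value are handled together and no
  value has to be chosen.\<close>

definition gen_to :: "'a \<Rightarrow> 'a \<Rightarrow> bool" where
  "gen_to x h \<longleftrightarrow> ((\<lambda>s. (T s x - x) /\<^sub>R s) \<longlongrightarrow> h) (at_right 0)"

lemma gen_to_unique: "gen_to x h \<Longrightarrow> gen_to x k \<Longrightarrow> h = k"
  unfolding gen_to_def by (rule tendsto_unique[rotated]) auto

lemma bounded_linear_T: "t \<ge> 0 \<Longrightarrow> bounded_linear (T t)"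
  using linear_T contraction_T
  by (auto simp: bounded_linear_def bounded_linear_axioms_def intro!: exI[of _ 1])

lemma norm_T_eq_norm_S: "t \<ge> 0 \<Longrightarrow> norm (T t x) = norm (S t x)"
  by (rule norm_eq_of_commuting_adjoint) (auto simp: adjoint commute)

text \<open>\<open>T (u + s) x - T u x = T u (T s x - x)\<close> is bounded by
  \<open>norm (T s x - x)\<close> independently of \<open>u\<close>. With \<open>u\<close> the
  smaller of two times this gives continuity from both sides.\<close>

lemma continuous_on_T: "continuous_on {0..} (\<lambda>t. T t x)"
  unfolding continuous_on_iff
proof (intro ballI allI impI)
  fix t e :: real assume t: "t \<in> {0..}" and e: "e > 0"
  from tendstoD[OF tendsto_T e, of x] obtain d where d: "d > 0"
    and D: "\<And>s. 0 < s \<Longrightarrow> s < d \<Longrightarrow> dist (T s x) x < e"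
    by (auto simp: eventually_at_right[of 0 1])
  have step: "dist (T (u + s) x) (T u x) < e" if "u \<ge> 0" "s \<ge> 0" "s < d" for u s
  proof (cases "s = 0")
    case False
    have "dist (T (u + s) x) (T u x) = norm (T u (T s x - x))"
      using that by (simp add: T_add dist_norm linear_diff[OF linear_T])
    also have "\<dots> \<le> norm (T s x - x)"
      using that by (simp add: contraction_T)
    also have "\<dots> < e"
      using D[of s] False that by (simp add: dist_norm)
    finally show ?thesis .
  qed (use e in simp)
  have "dist (T t' x) (T t x) < e" if "t' \<in> {0..}" "dist t' t < d" for t'
  proof (cases "t \<le> t'")
    case True
    with step[of t "t' - t"] t that show ?thesis by (simp add: dist_real_def)
  next
    case False
    with step[of t' "t - t'"] t that show ?thesis by (simp add: dist_real_def dist_commute)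
  qed
  with d show "\<exists>d>0. \<forall>t'\<in>{0..}. dist t' t < d \<longrightarrow> dist (T t' x) (T t x) < e"
    by blast
qed

lemma continuous_on_T': "A \<subseteq> {0..} \<Longrightarrow> continuous_on A (\<lambda>t. T t x)"
  using continuous_on_T continuous_on_subset by blast

text \<open>Despite the name, the integral is not divided by \<open>t\<close>:
  \<open>avg t x\<close> itself lies in the domain of the generator, and the division is made only
  where the mean has to approximate \<open>x\<close>.\<close>

definition avg :: "real \<Rightarrow> 'a \<Rightarrow> 'a" where
  "avg t x = integral {0..t} (\<lambda>s. T s x)"

lemma avg_add:
  assumes "r \<ge> 0" "t \<ge> 0"
  shows "avg (r + t) x = avg r x + T r (avg t x)"
proof -
  have int: "(\<lambda>s. T s x) integrable_on {a..b}" if "a \<ge> 0" for a b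
    by (intro integrable_continuous_interval continuous_on_T') (use that in auto)
  have "avg (r + t) x = avg r x + integral {r..r + t} (\<lambda>s. T s x)"
    unfolding avg_def using assms int
    by (intro Henstock_Kurzweil_Integration.integral_combine[symmetric]) auto
  also have "integral {r..r + t} (\<lambda>s. T s x) = integral {0..t} (\<lambda>s. T (s + r) x)"
    using integral_shift_Icc_real[of 0 t "\<lambda>s. T s x" r] by (simp add: o_def add.commute)
  also have "\<dots> = integral {0..t} (\<lambda>s. T r (T s x))"
    using assms by (intro integral_cong) (simp add: T_add[symmetric] add.commute)
  also have "\<dots> = T r (avg t x)"
    using integral_linear[OF int bounded_linear_T[OF assms(1)], of 0 t]
    by (simp add: avg_def o_def)
  finally show ?thesis .
qed

text \<open>The fundamental theorem of calculus at 0, where the integrand takes the value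
  \<open>T 0 x = x\<close>.\<close>

lemma avg_tendsto: "((\<lambda>t. avg t x /\<^sub>R t) \<longlongrightarrow> x) (at_right 0)"
proof -
  have "((\<lambda>u. avg u x) has_vector_derivative T 0 x) (at 0 within {0..1})"
    unfolding avg_def
    by (rule integral_has_vector_derivative) (auto intro: continuous_on_T')
  then have "((\<lambda>y. norm (avg y x - y *\<^sub>R x) / \<bar>y\<bar>) \<longlongrightarrow> 0) (at_right 0)"
    by (simp add: has_vector_derivative_def has_derivative_iff_norm at_within_Icc_at_right T_0)
       (simp add: avg_def)
  moreover have "\<forall>\<^sub>F y in at_right 0. norm (avg y x - y *\<^sub>R x) / \<bar>y\<bar> = norm (avg y x /\<^sub>R y - x)"
    using eventually_at_right_less
  proof eventually_elim
    case (elim y)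
    then have "avg y x /\<^sub>R y - x = (avg y x - y *\<^sub>R x) /\<^sub>R y"
      by (simp add: scaleR_diff_right)
    with elim show ?case by (simp add: divide_inverse)
  qed
  ultimately have "((\<lambda>y. norm (avg y x /\<^sub>R y - x)) \<longlongrightarrow> 0) (at_right 0)"
    by (rule Lim_transform_eventually)
  then show ?thesis
    by (rule LIM_zero_cancel[OF tendsto_norm_zero_cancel])
qed

lemma gen_to_avg:
  assumes "t \<ge> 0"
  shows "gen_to (avg t x) (T t x - x)"
  unfolding gen_to_def
proof (rule Lim_transform_eventually)
  show "((\<lambda>r. T t (avg r x /\<^sub>R r) - avg r x /\<^sub>R r) \<longlongrightarrow> T t x - x) (at_right 0)"
    using bounded_linear.tendsto[OF bounded_linear_T[OF assms] avg_tendsto]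
    by (intro tendsto_diff avg_tendsto)
  show "\<forall>\<^sub>F r in at_right 0. T t (avg r x /\<^sub>R r) - avg r x /\<^sub>R r = (T r (avg t x) - avg t x) /\<^sub>R r"
    using eventually_at_right_less
  proof eventually_elim
    case (elim r)
    \<comment> \<open>Cutting the integral over \<open>{0..r + t}\<close> at \<open>r\<close> or at
      \<open>t\<close> gives
      \<open>avg r x + T r (avg t x) = avg t x + T t (avg r x)\<close>.\<close>
    have "T r (avg t x) - avg t x = T t (avg r x) - avg r x"
      using avg_add[of r t x] avg_add[of t r x] assms elim by (simp add: algebra_simps)
    then show ?case
      using linear_scale[OF linear_T[OF assms]] by (simp add: scaleR_diff_right)
  qed
qed

lemma gen_to_scaleR:
  assumes "gen_to x h"
  shows "gen_to (c *\<^sub>R x) (c *\<^sub>R h)"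
  unfolding gen_to_def
proof (rule Lim_transform_eventually)
  show "((\<lambda>s. c *\<^sub>R ((T s x - x) /\<^sub>R s)) \<longlongrightarrow> c *\<^sub>R h) (at_right 0)"
    using assms unfolding gen_to_def by (intro tendsto_intros)
  show "\<forall>\<^sub>F s in at_right 0. c *\<^sub>R ((T s x - x) /\<^sub>R s) = (T s (c *\<^sub>R x) - c *\<^sub>R x) /\<^sub>R s"
    using eventually_at_right_less
    by eventually_elim (simp add: linear_scale[OF linear_T] scaleR_diff_right mult.commute)
qed

lemma gen_dom_dense:
  assumes "e > 0"
  shows "\<exists>y h. gen_to y h \<and> norm (x - y) < e"
proof -
  from tendstoD[OF avg_tendsto assms, of x] eventually_at_right_less[of "0::real"]
  have "\<forall>\<^sub>F t in at_right 0. 0 < t \<and> dist (avg t x /\<^sub>R t) x < e"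
    by eventually_elim auto
  then obtain t where "0 < t" "dist (avg t x /\<^sub>R t) x < e"
    by (metis (mono_tags, lifting) eventually_happens' trivial_limit_at_right_real)
  with gen_to_scaleR[OF gen_to_avg, of t "inverse t" x] show ?thesis
    by (intro exI[of _ "avg t x /\<^sub>R t"] exI[of _ "(T t x - x) /\<^sub>R t"]) (auto simp: dist_norm norm_minus_commute)
qed

section \<open>Duality between the two generators\<close>

lemma gen_to_adjoint:
  assumes "gen_to x h" "adjoint_semigroups.gen_to S y k"
  shows "inner h y = inner x k"
proof -
  interpret swap: adjoint_semigroups S T by (rule swap)
  have "((\<lambda>s. inner ((T s x - x) /\<^sub>R s) y) \<longlongrightarrow> inner h y) (at_right 0)"
    using assms(1) unfolding gen_to_def by (intro tendsto_intros)
  moreover have "((\<lambda>s. inner x ((S s y - y) /\<^sub>R s)) \<longlongrightarrow> inner x k) (at_right 0)"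
    using assms(2) unfolding swap.gen_to_def by (intro tendsto_intros)
  moreover have "\<forall>\<^sub>F s in at_right 0. inner ((T s x - x) /\<^sub>R s) y = inner x ((S s y - y) /\<^sub>R s)"
    using eventually_at_right_less
    by eventually_elim (simp add: inner_diff adjoint)
  ultimately show ?thesis
    by (intro tendsto_unique[OF trivial_limit_at_right_real _ _, OF Lim_transform_eventually])
qed

text \<open>Testing against \<open>avg t x\<close>, which the generator sends to \<open>T t x - x\<close>, shows
  \<open>S t y - y = \<integral>\<^sub>0\<^sup>t S s k ds\<close>.\<close>
lemma gen_adjoint_imp_gen_to:
  assumes "\<And>x h. gen_to x h \<Longrightarrow> inner h y = inner x k"
  shows "adjoint_semigroups.gen_to S y k"
proof -
  interpret swap: adjoint_semigroups S T by (rule swap)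
  have eq: "S t y - y = swap.avg t k" if t: "t \<ge> 0" for t
  proof -
    have "inner x (S t y - y) = inner x (swap.avg t k)" for x
    proof -
      have "inner x (S t y - y) = inner (T t x - x) y"
        using t by (simp add: adjoint inner_diff)
      also have "\<dots> = inner (avg t x) k"
        by (rule assms[OF gen_to_avg[OF t]])
      also have "\<dots> = integral {0..t} (\<lambda>s. inner (T s x) k)"
        unfolding avg_def
        by (subst integral_linear[OF _ bounded_linear_inner_left[of k], unfolded o_def])
           (auto intro!: integrable_continuous_interval continuous_on_T')
      also have "\<dots> = integral {0..t} (\<lambda>s. inner x (S s k))"
        by (intro integral_cong) (auto simp: adjoint)
      also have "\<dots> = inner x (swap.avg t k)"
        unfolding swap.avg_def
        by (subst integral_linear[OF _ bounded_linear_inner_right[of x], unfolded o_def])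
           (auto intro!: integrable_continuous_interval swap.continuous_on_T')
      finally show ?thesis .
    qed
    then show ?thesis
      by (rule vector_eq_ldot[THEN iffD1, rule_format])
  qed
  show ?thesis
    unfolding swap.gen_to_def
  proof (rule Lim_transform_eventually[OF swap.avg_tendsto])
    show "\<forall>\<^sub>F t in at_right 0. swap.avg t k /\<^sub>R t = (S t y - y) /\<^sub>R t"
      using eventually_at_right_less by eventually_elim (simp add: eq)
  qed
qed

lemma gen_to_imp_adjoint_gen_to:
  assumes "gen_to x h"
  obtains k where "adjoint_semigroups.gen_to S x k" "norm k = norm h"
proof -
  interpret swap: adjoint_semigroups S T by (rule swap)
  define d where "d = (\<lambda>s. (T s x - x) /\<^sub>R s)"
  define e where "e = (\<lambda>s. (S s x - x) /\<^sub>R s)"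
  have d: "(d \<longlongrightarrow> h) (at_right 0)"
    using assms by (simp add: gen_to_def d_def)
  note lin = linear_add[OF linear_T] linear_add[OF linear_S] linear_diff[OF linear_T] linear_diff[OF linear_S]
    linear_scale[OF linear_T] linear_scale[OF linear_S]
  have de0: "norm (d s) = norm (e s)" if "s \<ge> 0" for s
    unfolding d_def e_def
    by (rule norm_eq_of_commuting_adjoint[where X = "\<lambda>x. (T s x - x) /\<^sub>R s"
          and Y = "\<lambda>x. (S s x - x) /\<^sub>R s"])
       (use that in \<open>simp_all add: adjoint commute lin algebra_simps\<close>)
  have de: "norm (d s - d r) = norm (e s - e r)" if "s \<ge> 0" "r \<ge> 0" for s r
    unfolding d_def e_def
    by (rule norm_eq_of_commuting_adjoint[where
          X = "\<lambda>x. (T s x - x) /\<^sub>R s - (T r x - x) /\<^sub>R r" and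
          Y = "\<lambda>x. (S s x - x) /\<^sub>R s - (S r x - x) /\<^sub>R r"])
       (use that in \<open>simp_all add: adjoint commute lin algebra_simps\<close>)
  \<comment> \<open>Completeness is applied along one sequence of times; \<open>ek\<close> then
    extends the convergence to all \<open>s\<close> tending to 0.\<close>
  define u where "u = (\<lambda>n. 1 / real (Suc n))"
  have u: "filterlim u (at_right 0) sequentially"
    unfolding u_def filterlim_at
    using LIMSEQ_inverse_real_of_nat by (auto simp: inverse_eq_divide)
  have u0: "u n \<ge> 0" for n by (simp add: u_def)
  have du: "(\<lambda>n. d (u n)) \<longlonglongrightarrow> h"
    using d u by (rule filterlim_compose)
  then have "Cauchy (\<lambda>n. d (u n))"
    by (intro LIMSEQ_imp_Cauchy)
  then have "Cauchy (\<lambda>n. e (u n))"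
    by (simp add: Cauchy_def dist_norm de u0)
  then obtain k where k: "(\<lambda>n. e (u n)) \<longlonglongrightarrow> k"
    using Cauchy_convergent_iff convergentD by blast
  \<comment> \<open>The limit of \<open>de\<close> with \<open>r = u n\<close>: the distance of
    \<open>e s\<close> to its limit equals that of \<open>d s\<close> to \<open>h\<close>.\<close>
  have ek: "norm (e s - k) = norm (d s - h)" if "s \<ge> 0" for s
  proof -
    have "(\<lambda>n. norm (e s - e (u n))) \<longlonglongrightarrow> norm (e s - k)"
      by (intro tendsto_intros k)
    moreover have "(\<lambda>n. norm (e s - e (u n))) \<longlonglongrightarrow> norm (d s - h)"
      unfolding de[OF that u0, symmetric] by (intro tendsto_intros du)
    ultimately show ?thesis by (rule LIMSEQ_unique)
  qed
  have "((\<lambda>s. e s - k) \<longlongrightarrow> 0) (at_right 0)"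
  proof (rule tendsto_norm_zero_cancel, rule Lim_transform_eventually)
    show "((\<lambda>s. norm (d s - h)) \<longlongrightarrow> 0) (at_right 0)"
      using tendsto_norm_zero[OF LIM_zero[OF d]] .
    show "\<forall>\<^sub>F s in at_right 0. norm (d s - h) = norm (e s - k)"
      using eventually_at_right_less by eventually_elim (simp add: ek)
  qed
  then have ek': "swap.gen_to x k"
    unfolding swap.gen_to_def e_def[symmetric] by (rule LIM_zero_cancel)
  have "norm k = norm h"
    using tendsto_norm[OF k] tendsto_norm[OF du] unfolding de0[OF u0] by (rule LIMSEQ_unique)
  with ek' that show thesis by blast
qed

text \<open>The graph of the generator of \<open>T\<close> is that of the adjoint of the generator
  of \<open>S\<close>: \<open>gen_to_adjoint\<close> and \<open>gen_adjoint_imp_gen_to\<close> with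
  exchanged roles give the two inclusions. The identities that define an adjoint survive
  limits.\<close>

lemma gen_to_closed:
  assumes "\<And>n. gen_to (xs n) (hs n)" "xs \<longlonglongrightarrow> x" "hs \<longlonglongrightarrow> h"
  shows "gen_to x h"
proof -
  interpret swap: adjoint_semigroups S T by (rule swap)
  show ?thesis
  proof (rule swap.gen_adjoint_imp_gen_to)
    fix y k assume "swap.gen_to y k"
    then have "inner (hs n) y = inner (xs n) k" for n
      using assms(1) gen_to_adjoint by blast
    moreover have "(\<lambda>n. inner (hs n) y) \<longlonglongrightarrow> inner h y" "(\<lambda>n. inner (xs n) k) \<longlonglongrightarrow> inner x k"
      by (intro tendsto_intros assms)+
    ultimately have "inner h y = inner x k"
      by (simp add: LIMSEQ_unique)
    then show "inner k x = inner y h"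
      by (simp add: inner_commute)
  qed
qed

end

section \<open>The Hilbert space of square integrable functions\<close>

lemma sets_gauss [measurable_cong, simp]: "sets gauss = sets borel"
  by (simp add: gauss_def)

lemma space_gauss [simp]: "space gauss = UNIV"
  by (simp add: gauss_def)

lemma prob_space_gauss: "prob_space gauss"
proof
  have "emeasure gauss (space gauss) = (\<integral>\<^sup>+z. ennreal (exp (- ((cmod z)^2) / 2) / (2 * pi)) \<partial>lborel)"
    by (simp add: gauss_def emeasure_density)
  also have "\<dots> = (\<integral>\<^sup>+(z::complex). (\<Prod>b\<in>Basis. ennreal (std_normal_density (inner z b))) \<partial>lborel)"
  proof (rule nn_integral_cong)
    fix z :: complex
    have "exp (- ((cmod z)^2) / 2) = exp (- ((Re z)^2) / 2) * exp (- ((Im z)^2) / 2)"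
      unfolding exp_add[symmetric] cmod_power2 by (simp add: add_divide_distrib)
    then have "exp (- ((cmod z)^2) / 2) / (2 * pi) = std_normal_density (Re z) * std_normal_density (Im z)"
      by (simp add: std_normal_density_def)
    then show "ennreal (exp (- ((cmod z)^2) / 2) / (2 * pi)) = (\<Prod>b\<in>Basis. ennreal (std_normal_density (inner z b)))"
      by (simp add: Basis_complex_def ennreal_mult)
  qed
  also have "\<dots> = (\<Prod>b\<in>(Basis::complex set). (\<integral>\<^sup>+x. ennreal (std_normal_density x) \<partial>lborel))"
    by (rule nn_integral_lborel_prod) auto
  also have "(\<integral>\<^sup>+x. ennreal (std_normal_density x) \<partial>lborel) = 1"
    by (subst nn_integral_eq_integral) (auto intro: integrable_normal_density simp: integral_normal_density)
  finally show "emeasure gauss (space gauss) = 1" by simp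
qed

interpretation gauss: prob_space gauss
  by (rule prob_space_gauss)

lemma borel_measurable_cnj [measurable (raw)]:
  "f \<in> borel_measurable M \<Longrightarrow> (\<lambda>x. cnj (f x)) \<in> borel_measurable M"
  by (rule borel_measurable_continuous_on) (auto intro: continuous_intros)

lemma L2_measurable [measurable_dest]: "L2 f \<Longrightarrow> f \<in> borel_measurable borel"
  using measurable_cong_sets[OF sets_gauss refl] by (auto simp: L2_def)

lemma L2_square: "L2 f \<Longrightarrow> integrable gauss (\<lambda>x. (cmod (f x))^2)"
  by (simp add: L2_def)

lemma L2I:
  assumes "f \<in> borel_measurable borel" "integrable gauss (\<lambda>x. (cmod (f x))^2)"
  shows "L2 f"
  using assms measurable_cong_sets[OF sets_gauss refl] by (auto simp: L2_def)

lemma L2_bound: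
  assumes [measurable]: "f \<in> borel_measurable borel" and "integrable gauss g"
    and "AE x in gauss. (cmod (f x))^2 \<le> g x"
  shows "L2 f"
proof (rule L2I)
  show "integrable gauss (\<lambda>x. (cmod (f x))^2)"
    using assms(2) by (rule Bochner_Integration.integrable_bound) (use assms(3) in auto)
qed fact

lemma cmod_mult_cnj_le: "cmod (u * cnj v) \<le> (cmod u)^2 + (cmod v)^2"
  using sum_squares_bound[of "cmod u" "cmod v"]
    mult_nonneg_nonneg[OF norm_ge_zero norm_ge_zero, of u v]
  unfolding norm_mult complex_mod_cnj mult.assoc by linarith

lemma L2_integrable_mult_cnj:
  assumes [measurable]: "L2 f" "L2 g"
  shows "integrable gauss (\<lambda>x. f x * cnj (g x))"
proof (rule Bochner_Integration.integrable_bound)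
  show "integrable gauss (\<lambda>x. (cmod (f x))^2 + (cmod (g x))^2)"
    using assms by (intro Bochner_Integration.integrable_add L2_square)
  show "AE x in gauss. norm (f x * cnj (g x)) \<le> norm ((cmod (f x))^2 + (cmod (g x))^2)"
    by (simp add: cmod_mult_cnj_le)
qed measurable

lemma L2_bounded:
  assumes "f \<in> borel_measurable borel" "\<And>x. cmod (f x) \<le> B"
  shows "L2 f"
  by (rule L2_bound[OF assms(1), of "\<lambda>_. B^2"]) (auto intro!: power_mono assms)

lemma L2_const [simp]: "L2 (\<lambda>_. c)"
  by (rule L2_bounded[of _ "cmod c"]) auto

lemma L2_integrable: "L2 f \<Longrightarrow> integrable gauss f"
  using L2_integrable_mult_cnj[of f "\<lambda>_. 1"] by simp

lemma L2_add:
  assumes [measurable]: "L2 f" "L2 g"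
  shows "L2 (\<lambda>x. f x + g x)"
proof (rule L2_bound)
  show "integrable gauss (\<lambda>x. 2 * (cmod (f x))^2 + 2 * (cmod (g x))^2)"
    using assms by (intro Bochner_Integration.integrable_add integrable_mult_right L2_square)
  have "(cmod (f x + g x))^2 \<le> 2 * (cmod (f x))^2 + 2 * (cmod (g x))^2" for x
  proof -
    have "(cmod (f x + g x))^2 \<le> (cmod (f x) + cmod (g x))^2"
      by (intro power_mono norm_triangle_ineq) auto
    also have "\<dots> \<le> 2 * (cmod (f x))^2 + 2 * (cmod (g x))^2"
      using sum_squares_bound[of "cmod (f x)" "cmod (g x)"] by (simp add: power2_sum)
    finally show ?thesis .
  qed
  then show "AE x in gauss. (cmod (f x + g x))^2 \<le> 2 * (cmod (f x))^2 + 2 * (cmod (g x))^2"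
    by simp
qed measurable

lemma L2_mult:
  assumes [measurable]: "L2 f"
  shows "L2 (\<lambda>x. c * f x)"
proof (rule L2_bound)
  show "integrable gauss (\<lambda>x. (cmod c)^2 * (cmod (f x))^2)"
    using assms by (intro integrable_mult_right L2_square)
qed (auto simp: norm_mult power_mult_distrib)

lemma L2_uminus: "L2 f \<Longrightarrow> L2 (\<lambda>x. - f x)"
  using L2_mult[of f "-1"] by simp

lemma L2_diff: "L2 f \<Longrightarrow> L2 g \<Longrightarrow> L2 (\<lambda>x. f x - g x)"
  using L2_add[of f "\<lambda>x. - g x"] L2_uminus[of g] by simp

lemma L2_scaleR: "L2 f \<Longrightarrow> L2 (\<lambda>x. r *\<^sub>R f x)"
  using L2_mult[of f "of_real r"] by (simp add: scaleR_conv_of_real)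

lemma L2_inner_self: "Re (L2inner f f) = (\<integral>x. (cmod (f x))^2 \<partial>gauss)"
  unfolding L2inner_def complex_norm_square[symmetric]
  by (simp flip: of_real_power)

text \<open>A partial equivalence whose field consists of the square integrable functions.
  \<open>abs_l2\<close> is meaningful only there, hence the \<open>L2\<close> hypotheses in the
  rules about classes.\<close>

definition L2eq :: "(complex \<Rightarrow> complex) \<Rightarrow> (complex \<Rightarrow> complex) \<Rightarrow> bool" where
  "L2eq f g \<longleftrightarrow> L2 f \<and> L2 g \<and> (AE x in gauss. f x = g x)"

quotient_type l2 = "complex \<Rightarrow> complex" / partial: L2eq
proof (rule part_equivpI)
  show "\<exists>f. L2eq f f"
    by (rule exI[of _ "\<lambda>_. 0"]) (simp add: L2eq_def)
  show "symp L2eq"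
    by (auto simp: symp_def L2eq_def elim: AE_mp)
  show "transp L2eq"
    by (auto simp: transp_def L2eq_def)
qed

instantiation l2 :: real_inner
begin

lift_definition zero_l2 :: l2 is "\<lambda>_. 0" by (simp add: L2eq_def)
lift_definition plus_l2 :: "l2 \<Rightarrow> l2 \<Rightarrow> l2" is "\<lambda>f g x. f x + g x"
  by (auto simp: L2eq_def L2_add)
lift_definition minus_l2 :: "l2 \<Rightarrow> l2 \<Rightarrow> l2" is "\<lambda>f g x. f x - g x"
  by (auto simp: L2eq_def L2_diff)
lift_definition uminus_l2 :: "l2 \<Rightarrow> l2" is "\<lambda>f x. - f x"
  by (auto simp: L2eq_def L2_uminus)
lift_definition scaleR_l2 :: "real \<Rightarrow> l2 \<Rightarrow> l2" is "\<lambda>r f x. r *\<^sub>R f x"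
  by (auto simp: L2eq_def L2_scaleR)
lift_definition inner_l2 :: "l2 \<Rightarrow> l2 \<Rightarrow> real" is "\<lambda>f g. Re (L2inner f g)"
proof -
  fix f f' g g' assume "L2eq f f'" "L2eq g g'"
  then have [measurable]: "L2 f" "L2 f'" "L2 g" "L2 g'"
    and ae: "AE x in gauss. f x = f' x" "AE x in gauss. g x = g' x"
    by (auto simp: L2eq_def)
  show "Re (L2inner f g) = Re (L2inner f' g')"
    unfolding L2inner_def
    by (intro arg_cong[where f = Re] integral_cong_AE, measurable) (use ae in auto)
qed

definition norm_l2 :: "l2 \<Rightarrow> real" where "norm_l2 x = sqrt (inner x x)"
definition dist_l2 :: "l2 \<Rightarrow> l2 \<Rightarrow> real" where "dist_l2 x y = norm (x - y)"
definition sgn_l2 :: "l2 \<Rightarrow> l2" where "sgn_l2 x = scaleR (inverse (norm x)) x"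
definition uniformity_l2 :: "(l2 \<times> l2) filter" where
  "uniformity_l2 = (INF e\<in>{0 <..}. principal {(x, y). dist x y < e})"
definition open_l2 :: "l2 set \<Rightarrow> bool" where
  "open_l2 U \<longleftrightarrow> (\<forall>x\<in>U. \<forall>\<^sub>F (x', y) in uniformity. x' = x \<longrightarrow> y \<in> U)"

instance
proof
  fix x y z :: l2 and a b :: real
  show "x + y + z = x + (y + z)" by transfer (simp add: L2eq_def L2_add add.assoc)
  show "x + y = y + x" by transfer (simp add: L2eq_def L2_add add.commute)
  show "0 + x = x" by transfer (simp add: L2eq_def)
  show "- x + x = 0" by transfer (simp add: L2eq_def)
  show "x - y = x + - y" by transfer (simp add: L2eq_def L2_diff)
  show "a *\<^sub>R (x + y) = a *\<^sub>R x + a *\<^sub>R y"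
    by transfer (simp add: L2eq_def L2_add L2_scaleR scaleR_add_right)
  show "(a + b) *\<^sub>R x = a *\<^sub>R x + b *\<^sub>R x"
    by transfer (simp add: L2eq_def L2_add L2_scaleR scaleR_add_left)
  show "a *\<^sub>R b *\<^sub>R x = (a * b) *\<^sub>R x" by transfer (simp add: L2eq_def L2_scaleR)
  show "1 *\<^sub>R x = x" by transfer (simp add: L2eq_def)
  show "inner x y = inner y x"
  proof transfer
    fix f g :: "complex \<Rightarrow> complex"
    have "cnj (L2inner g f) = (\<integral>x. cnj (g x * cnj (f x)) \<partial>gauss)"
      unfolding L2inner_def by (rule Bochner_Integration.integral_cnj[symmetric])
    also have "\<dots> = L2inner f g"
      by (simp add: L2inner_def mult.commute del: integral_cnj)
    finally have "cnj (L2inner g f) = L2inner f g" .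
    then show "Re (L2inner f g) = Re (L2inner g f)"
      by (metis cnj.sel(1))
  qed
  show "inner (x + y) z = inner x z + inner y z"
    by transfer (simp add: L2inner_def L2eq_def distrib_right L2_integrable_mult_cnj)
  show "inner (a *\<^sub>R x) y = a * inner x y"
    by transfer (simp add: L2inner_def)
  show "0 \<le> inner x x"
    by transfer (simp add: L2_inner_self L2eq_def)
  show "(inner x x = 0) = (x = 0)"
    by transfer (simp add: L2_inner_self L2eq_def integral_nonneg_eq_0_iff_AE L2_square)
qed (simp_all add: norm_l2_def dist_l2_def sgn_l2_def uniformity_l2_def open_l2_def)

end

abbreviation cls :: "(complex \<Rightarrow> complex) \<Rightarrow> l2" where "cls \<equiv> abs_l2"

lemma ex_cls: obtains f where "L2 f" "cls f = x"
proof
  show "L2 (rep_l2 x)"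
    using Quotient_rep_reflp[OF Quotient_l2, of x] by (simp add: L2eq_def)
  show "cls (rep_l2 x) = x"
    by (rule Quotient_abs_rep[OF Quotient_l2])
qed

lemma cls_eq_iff: "L2 f \<Longrightarrow> L2 g \<Longrightarrow> cls f = cls g \<longleftrightarrow> (AE x in gauss. f x = g x)"
  using Quotient_rel[OF Quotient_l2, of f g] by (auto simp: L2eq_def)

lemma cls_add: "L2 f \<Longrightarrow> L2 g \<Longrightarrow> cls (\<lambda>x. f x + g x) = cls f + cls g"
  by (simp add: plus_l2.abs_eq L2eq_def)

lemma cls_diff: "L2 f \<Longrightarrow> L2 g \<Longrightarrow> cls (\<lambda>x. f x - g x) = cls f - cls g"
  by (simp add: minus_l2.abs_eq L2eq_def)

lemma cls_scaleR: "L2 f \<Longrightarrow> cls (\<lambda>x. r *\<^sub>R f x) = r *\<^sub>R cls f"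
  by (simp add: scaleR_l2.abs_eq L2eq_def)

lemma cls_zero: "cls (\<lambda>_. 0) = 0"
  by (simp add: zero_l2_def)

lemma inner_cls: "L2 f \<Longrightarrow> L2 g \<Longrightarrow> inner (cls f) (cls g) = Re (L2inner f g)"
  by (simp add: inner_l2.abs_eq L2eq_def)

lemma norm_cls: "L2 f \<Longrightarrow> norm (cls f) = L2norm f"
  by (simp add: norm_l2_def inner_cls L2norm_def L2_inner_self)

lemma norm_cls_diff: "L2 f \<Longrightarrow> L2 g \<Longrightarrow> norm (cls f - cls g) = L2norm (\<lambda>x. f x - g x)"
  by (simp add: norm_cls[symmetric] L2_diff cls_diff)

text \<open>Cauchy-Schwarz in \<open>l2\<close> against the constant 1, which has norm 1 because
  \<open>gauss\<close> is a probability measure.\<close>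

lemma integral_norm_le_L2norm:
  assumes [measurable]: "L2 f"
  shows "(\<integral>x. cmod (f x) \<partial>gauss) \<le> L2norm f"
proof -
  have L: "L2 (\<lambda>x. of_real (cmod (f x)))"
    by (rule L2_bound[OF _ L2_square[OF assms]]) auto
  have "(\<integral>x. cmod (f x) \<partial>gauss) = inner (cls (\<lambda>x. of_real (cmod (f x)))) (cls (\<lambda>_. 1))"
    using L L2_integrable[OF L] by (simp add: inner_cls L2inner_def)
  also have "\<dots> \<le> norm (cls (\<lambda>x. of_real (cmod (f x)))) * norm (cls (\<lambda>_. 1))"
    by (rule norm_cauchy_schwarz)
  also have "\<dots> = L2norm f"
    using L gauss.prob_space by (simp add: norm_cls) (simp add: L2norm_def)
  finally show ?thesis .
qed


section \<open>Completeness of \<open>l2\<close>\<close>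

lemma Fatou_L2:
  assumes [measurable]: "\<And>k. L2 (F k)" "f \<in> borel_measurable borel"
    and lim: "AE x in gauss. (\<lambda>k. F k x) \<longlonglongrightarrow> f x"
    and bound: "\<And>k. norm (cls (F k)) \<le> B"
  shows "L2 f" "norm (cls f) \<le> B"
proof -
  have B: "B \<ge> 0" using bound[of 0] norm_ge_zero order_trans by blast
  have eq: "(\<integral>\<^sup>+x. ennreal ((cmod (F k x))^2) \<partial>gauss) = ennreal ((norm (cls (F k)))^2)" for k
    by (subst nn_integral_eq_integral)
       (use assms(1) in \<open>auto intro: L2_square simp: norm_cls L2norm_def\<close>)
  have "(\<integral>\<^sup>+x. ennreal ((cmod (f x))^2) \<partial>gauss) =
      (\<integral>\<^sup>+x. liminf (\<lambda>k. ennreal ((cmod (F k x))^2)) \<partial>gauss)"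
  proof (rule nn_integral_cong_AE, use lim in eventually_elim)
    case (elim x)
    then have "(\<lambda>k. ennreal ((cmod (F k x))^2)) \<longlonglongrightarrow> ennreal ((cmod (f x))^2)"
      by (intro tendsto_intros tendsto_ennrealI)
    from lim_imp_Liminf[OF _ this] show ?case by simp
  qed
  also have "\<dots> \<le> liminf (\<lambda>k. (\<integral>\<^sup>+x. ennreal ((cmod (F k x))^2) \<partial>gauss))"
    by (rule nn_integral_liminf) measurable
  also have "\<dots> \<le> ennreal (B^2)"
    unfolding eq by (rule order_trans[OF Liminf_mono[of _ "\<lambda>_. ennreal (B^2)"]])
       (auto intro!: always_eventually ennreal_leI power_mono bound simp: Liminf_const)
  finally have le: "(\<integral>\<^sup>+x. ennreal ((cmod (f x))^2) \<partial>gauss) \<le> ennreal (B^2)" .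
  have int: "integrable gauss (\<lambda>x. (cmod (f x))^2)"
    by (rule integrableI_nonneg) (use le in \<open>auto simp: less_top[symmetric] top_unique\<close>)
  then show L: "L2 f" by (intro L2I) auto
  have "(norm (cls f))^2 \<le> B^2"
    using le int by (subst (asm) nn_integral_eq_integral) (auto simp: norm_cls L L2norm_def)
  then show "norm (cls f) \<le> B"
    using B by (rule power2_le_imp_le)
qed

lemma Cauchy_imp_fast_subseq:
  fixes X :: "nat \<Rightarrow> 'a::metric_space"
  assumes "Cauchy X"
  obtains r where "strict_mono r" "\<And>n m. m \<ge> r n \<Longrightarrow> dist (X m) (X (r n)) < (1/2)^n"
proof -
  have "\<exists>N. \<forall>m\<ge>N. \<forall>k\<ge>N. dist (X m) (X k) < (1/2)^n" for n :: nat
    using assms by (auto simp: Cauchy_def)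
  then obtain N where N: "\<And>n m k. m \<ge> N n \<Longrightarrow> k \<ge> N n \<Longrightarrow> dist (X m) (X k) < (1/2)^n"
    by metis
  \<comment> \<open>\<open>Suc k\<close> makes the recursion strictly increasing, and
    \<open>N (Suc n)\<close> keeps the next index beyond its own threshold.\<close>
  define r where "r = rec_nat (N 0) (\<lambda>n k. max (Suc k) (N (Suc n)))"
  have r: "r n \<ge> N n" for n
    by (cases n) (auto simp: r_def)
  have "strict_mono r"
    by (rule strict_monoI_Suc) (auto simp: r_def)
  with r N that show thesis
    by (meson order_trans)
qed

text \<open>The Riesz-Fischer argument: along a fast subsequence the increments of the
  representatives are summable almost everywhere, and Fatou's lemma turns the pointwise limit into a
  limit in norm.\<close>

instance l2 :: banach
proof
  fix X :: "nat \<Rightarrow> l2" assume X: "Cauchy X"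
  obtain r where r: "strict_mono r" "\<And>n m. m \<ge> r n \<Longrightarrow> dist (X m) (X (r n)) < (1/2)^n"
    using Cauchy_imp_fast_subseq[OF X] by metis
  have "\<forall>n. \<exists>f. L2 f \<and> cls f = X n" by (metis ex_cls)
  then obtain F where L[measurable]: "\<And>n. L2 (F n)" and F: "\<And>n. cls (F n) = X n" by metis
  define d where "d = (\<lambda>n x. F (r (Suc n)) x - F (r n) x)"
  have Ld[measurable]: "L2 (d n)" for n
    unfolding d_def by (intro L2_diff L)
  have "norm (cls (d n)) \<le> (1/2)^n" for n
    using r(2)[of n "r (Suc n)"] strict_mono_leD[OF r(1), of n "Suc n"]
    by (simp add: d_def cls_diff L F dist_norm)
  then have dn: "(\<integral>x. cmod (d n x) \<partial>gauss) \<le> (1/2)^n" for n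
    using integral_norm_le_L2norm[OF Ld, of n] by (metis Ld norm_cls order_trans)
  have "(\<integral>\<^sup>+x. (\<Sum>n. ennreal (cmod (d n x))) \<partial>gauss) = (\<Sum>n. (\<integral>\<^sup>+x. ennreal (cmod (d n x)) \<partial>gauss))"
    by (rule nn_integral_suminf) measurable
  also have "\<dots> = (\<Sum>n. ennreal (\<integral>x. cmod (d n x) \<partial>gauss))"
    by (intro suminf_cong nn_integral_eq_integral) (auto intro!: integrable_norm L2_integrable Ld)
  also have "\<dots> \<le> (\<Sum>n. ennreal ((1/2)^n))"
    by (intro suminf_le ennreal_leI dn) auto
  also have "\<dots> = ennreal (\<Sum>n. (1/2)^n)"
    by (rule suminf_ennreal2) (auto intro: summable_geometric)
  finally have "(\<integral>\<^sup>+x. (\<Sum>n. ennreal (cmod (d n x))) \<partial>gauss) \<noteq> \<infinity>"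
    by (auto simp: top_unique)
  then have "AE x in gauss. (\<Sum>n. ennreal (cmod (d n x))) \<noteq> \<infinity>"
    by (intro nn_integral_PInf_AE) auto
  then have conv: "AE x in gauss. convergent (\<lambda>k. F (r k) x)"
  proof eventually_elim
    case (elim x)
    then have "summable (\<lambda>n. cmod (d n x))"
      by (intro summable_suminf_not_top) auto
    then have "summable (\<lambda>n. d n x)"
      by (rule summable_norm_cancel)
    then have "convergent (\<lambda>k. \<Sum>n<k. d n x)"
      by (simp add: summable_iff_convergent)
    then have "convergent (\<lambda>k. F (r k) x - F (r 0) x)"
      unfolding d_def sum_lessThan_telescope[of "\<lambda>k. F (r k) x"] .
    then show ?case
      using convergent_diff_const_right_iff by blast
  qed
  \<comment> \<open>Where the sequence diverges \<open>lim\<close> returns an unspecified constant;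
    this happens only on a null set and does not disturb measurability.\<close>
  define f where "f = (\<lambda>x. lim (\<lambda>k. F (r k) x))"
  have fm[measurable]: "f \<in> borel_measurable borel"
    unfolding f_def by measurable
  have lim: "AE x in gauss. (\<lambda>k. F (r k) x) \<longlonglongrightarrow> f x"
    using conv by eventually_elim (simp add: f_def convergent_LIMSEQ_iff)
  \<comment> \<open>Fatou's lemma is applied to differences with a fixed \<open>F (r n)\<close>. One
    estimate then yields the rate of convergence and, for \<open>n = 0\<close>, the square
    integrability of \<open>f\<close>.\<close>
  have near: "L2 (\<lambda>x. F (r n) x - f x) \<and> norm (cls (\<lambda>x. F (r n) x - f x)) \<le> (1/2)^n" for n
  proof -
    define G where "G = (\<lambda>k x. F (r n) x - F (r (n + k)) x)"
    have G: "L2 (G k)" for k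
      unfolding G_def by (intro L2_diff L)
    have 1: "norm (cls (G k)) \<le> (1/2)^n" for k
      using r(2)[of n "r (n + k)"] strict_mono_leD[OF r(1), of n "n + k"]
      by (simp add: G_def cls_diff L F dist_norm norm_minus_commute)
    have 2: "AE x in gauss. (\<lambda>k. G k x) \<longlonglongrightarrow> F (r n) x - f x"
      using lim unfolding G_def
    proof eventually_elim
      case (elim x)
      from LIMSEQ_ignore_initial_segment[OF this, of n]
      show ?case by (intro tendsto_intros) (simp add: add.commute)
    qed
    show ?thesis
      using Fatou_L2[OF G _ 2 1] by simp
  qed
  have Lf: "L2 f"
    using L2_diff[OF L[of "r 0"] conjunct1[OF near[of 0]]] by simp
  have "norm (X (r n) - cls f) \<le> (1/2)^n" for n
    using near[of n] by (simp add: cls_diff L Lf F)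
  moreover have "(\<lambda>n. (1/2::real)^n) \<longlonglongrightarrow> 0"
    by (rule LIMSEQ_power_zero) simp
  ultimately have "(\<lambda>n. X (r n) - cls f) \<longlonglongrightarrow> 0"
    by (rule Lim_null_comparison[OF always_eventually, rule_format])
  then have "(X \<circ> r) \<longlonglongrightarrow> cls f"
    by (simp add: LIM_zero_iff o_def)
  then have "X \<longlonglongrightarrow> cls f"
    using X r(1) Cauchy_converges_subseq by blast
  then show "convergent X"
    by (rule convergentI)
qed

section \<open>Rotations of independent Gaussian variables\<close>

text \<open>The factor is \<open>c\<^sup>2\<close> because a real dilation acts on both real
  coordinates of the plane.\<close>

lemma nn_integral_complex_affine:
  fixes c :: real and f :: "complex \<Rightarrow> ennreal"
  assumes [measurable]: "f \<in> borel_measurable borel" and "c \<noteq> 0"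
  shows "(\<integral>\<^sup>+z. f z \<partial>lborel) = ennreal (c\<^sup>2) * (\<integral>\<^sup>+z. f (t + of_real c * z) \<partial>lborel)"
  by (subst lborel_affine[OF \<open>c \<noteq> 0\<close>, of t])
     (simp add: nn_integral_density nn_integral_distr nn_integral_cmult scaleR_conv_of_real)

interpretation gauss2: pair_prob_space gauss gauss ..

definition compl :: "complex \<Rightarrow> real" where
  "compl a = sqrt (1 - (cmod a)\<^sup>2)"

definition rot :: "complex \<Rightarrow> complex \<times> complex \<Rightarrow> complex \<times> complex" where
  "rot a = (\<lambda>(x, y). (a * x + complex_of_real (compl a) * y, complex_of_real (compl a) * x - cnj a * y))"

lemma compl_square: "cmod a \<le> 1 \<Longrightarrow> (compl a)\<^sup>2 = 1 - (cmod a)\<^sup>2"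
  by (simp add: compl_def abs_square_le_1)

lemma compl_pos: "cmod a < 1 \<Longrightarrow> 0 < compl a"
  by (simp add: compl_def abs_square_less_1)

lemma compl_cnj [simp]: "compl (cnj a) = compl a"
  by (simp add: compl_def)

lemma compl_1 [simp]: "compl 1 = 0"
  by (simp add: compl_def)

lemma compl_complex: "cmod a \<le> 1 \<Longrightarrow> complex_of_real (compl a) * complex_of_real (compl a) + cnj a * a = 1"
  using compl_square[of a]
  by (metis (no_types, opaque_lifting) complex_norm_square diff_add_cancel mult.commute of_real_1 of_real_add of_real_power power2_eq_square)

text \<open>The first coordinate of \<open>rot (cnj a) (rot a (x, y)) = (x, y)\<close>, written
  out.\<close>

lemma rot_inverse: "cmod a \<le> 1 \<Longrightarrow> cnj a * (a * x + of_real (compl a) * y) +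
    of_real (compl a) * (of_real (compl a) * x - cnj a * y) = x"
  using compl_complex[of a] by algebra

lemma rot_norm:
  assumes "cmod a \<le> 1"
  shows "(cmod (fst (rot a (x, y))))\<^sup>2 + (cmod (snd (rot a (x, y))))\<^sup>2 = (cmod x)\<^sup>2 + (cmod y)\<^sup>2"
proof -
  \<comment> \<open>Over the complex numbers the squared moduli become products with conjugates, and
    the claim is a polynomial consequence of \<open>compl_complex\<close>.\<close>
  have "complex_of_real ((cmod (fst (rot a (x, y))))\<^sup>2 + (cmod (snd (rot a (x, y))))\<^sup>2) =
        complex_of_real ((cmod x)\<^sup>2 + (cmod y)\<^sup>2)"
    unfolding of_real_add complex_norm_square rot_def using compl_complex[OF assms]
    by (simp, algebra)
  then show ?thesis by (simp only: of_real_eq_iff)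
qed

lemma measurable_rot [measurable]: "rot a \<in> measurable (gauss \<Otimes>\<^sub>M gauss) (gauss \<Otimes>\<^sub>M gauss)"
  unfolding rot_def by measurable

text \<open>The variables are changed one at a time: for fixed \<open>x\<close>,
  \<open>u = a x + s y\<close>; then, with the integrals exchanged, for fixed \<open>u\<close>,
  \<open>x = cnj a u + s v\<close>. Both substitutions dilate by the real number \<open>s\<close>
  and translate, and the two factors \<open>s\<^sup>2\<close> cancel.\<close>

lemma nn_integral_rot:
  assumes [measurable]: "F \<in> borel_measurable (borel \<Otimes>\<^sub>M borel)" and a: "cmod a < 1"
  shows "(\<integral>\<^sup>+x. \<integral>\<^sup>+y. F (rot a (x, y)) \<partial>gauss \<partial>gauss) = (\<integral>\<^sup>+u. \<integral>\<^sup>+v. F (u, v) \<partial>gauss \<partial>gauss)"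
proof -
  define w where "w z = ennreal (exp (- ((cmod z)^2) / 2) / (2 * pi))" for z
  have [measurable]: "w \<in> borel_measurable borel"
    unfolding w_def by measurable
  have ww: "w x * w y = ennreal (exp (- ((cmod x)^2 + (cmod y)^2) / 2) / (2 * pi)^2)" for x y
    unfolding w_def by (simp add: ennreal_mult[symmetric] exp_add[symmetric] power2_eq_square field_simps)
  define s where "s = compl a"
  have s: "s > 0" using a by (simp add: s_def compl_pos)
  \<comment> \<open>The Gaussian weights are absorbed into the integrand; by \<open>rot_norm\<close>
    their product has the same value at \<open>(x, y)\<close> and at
    \<open>rot a (x, y)\<close>.\<close>
  define K where "K = (\<lambda>(u, v). w u * w v * F (u, v))"
  have [measurable]: "K \<in> borel_measurable (borel \<Otimes>\<^sub>M borel)"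
    unfolding K_def by measurable
  have dens: "(\<integral>\<^sup>+x. \<integral>\<^sup>+y. G (x, y) \<partial>gauss \<partial>gauss) =
      (\<integral>\<^sup>+x. \<integral>\<^sup>+y. w x * w y * G (x, y) \<partial>lborel \<partial>lborel)"
    if [measurable]: "G \<in> borel_measurable (borel \<Otimes>\<^sub>M borel)" for G :: "complex \<times> complex \<Rightarrow> ennreal"
    unfolding gauss_def w_def[symmetric]
    by (simp add: nn_integral_density nn_integral_cmult mult.assoc)
  have rm: "(\<lambda>p. F (rot a p)) \<in> borel_measurable (borel \<Otimes>\<^sub>M borel)"
    unfolding rot_def by measurable
  have "ennreal (s\<^sup>2) * (\<integral>\<^sup>+x. \<integral>\<^sup>+y. F (rot a (x, y)) \<partial>gauss \<partial>gauss) =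
      ennreal (s\<^sup>2) * (\<integral>\<^sup>+x. \<integral>\<^sup>+y. K (rot a (x, y)) \<partial>lborel \<partial>lborel)"
    unfolding dens[OF rm] using a
    by (auto intro!: arg_cong[where f = "(*) _"] nn_integral_cong
        simp: K_def case_prod_beta ww rot_norm simp del: minus_add_distrib)
  also have "\<dots> = (\<integral>\<^sup>+x. ennreal (s\<^sup>2) * (\<integral>\<^sup>+y. K (rot a (x, y)) \<partial>lborel) \<partial>lborel)"
    unfolding rot_def by (subst nn_integral_cmult) auto
  also have "\<dots> = (\<integral>\<^sup>+x. \<integral>\<^sup>+u. K (u, (x - cnj a * u) / of_real s) \<partial>lborel \<partial>lborel)"
  proof (rule nn_integral_cong)
    fix x
    \<comment> \<open>The second coordinate of \<open>rot a (x, y)\<close>, expressed through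
      \<open>x\<close> and the new variable \<open>u = a x + s y\<close>.\<close>
    have "of_real s * x - cnj a * y = (x - cnj a * (a * x + of_real s * y)) / of_real s" for y
      using rot_inverse[of a x y] a s unfolding s_def[symmetric] by (simp add: field_simps)
    then show "ennreal (s\<^sup>2) * (\<integral>\<^sup>+y. K (rot a (x, y)) \<partial>lborel) =
        (\<integral>\<^sup>+u. K (u, (x - cnj a * u) / of_real s) \<partial>lborel)"
      using s by (subst nn_integral_complex_affine[of _ s "a * x"])
         (auto simp: rot_def s_def[symmetric])
  qed
  also have "\<dots> = (\<integral>\<^sup>+u. \<integral>\<^sup>+x. K (u, (x - cnj a * u) / of_real s) \<partial>lborel \<partial>lborel)"
    by (rule lborel_pair.Fubini') measurable
  also have "\<dots> = (\<integral>\<^sup>+u. ennreal (s\<^sup>2) * (\<integral>\<^sup>+v. K (u, v) \<partial>lborel) \<partial>lborel)"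
  proof (rule nn_integral_cong)
    show "(\<integral>\<^sup>+x. K (u, (x - cnj a * u) / of_real s) \<partial>lborel) = ennreal (s\<^sup>2) * (\<integral>\<^sup>+v. K (u, v) \<partial>lborel)" for u
      using s by (subst nn_integral_complex_affine[of _ s "cnj a * u"]) auto
  qed
  also have "\<dots> = ennreal (s\<^sup>2) * (\<integral>\<^sup>+u. \<integral>\<^sup>+v. K (u, v) \<partial>lborel \<partial>lborel)"
    by (subst nn_integral_cmult) auto
  also have "\<dots> = ennreal (s\<^sup>2) * (\<integral>\<^sup>+u. \<integral>\<^sup>+v. F (u, v) \<partial>gauss \<partial>gauss)"
    by (subst dens) (auto simp: K_def)
  finally show ?thesis
    using s by (simp add: ennreal_mult_cancel_left)
qed

lemma distr_rot:
  assumes "cmod a < 1"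
  shows "distr (gauss \<Otimes>\<^sub>M gauss) (gauss \<Otimes>\<^sub>M gauss) (rot a) = gauss \<Otimes>\<^sub>M gauss"
proof (rule measure_eqI)
  fix A assume "A \<in> sets (distr (gauss \<Otimes>\<^sub>M gauss) (gauss \<Otimes>\<^sub>M gauss) (rot a))"
  then have A[measurable]: "A \<in> sets (gauss \<Otimes>\<^sub>M gauss)" by simp
  have [measurable]: "A \<in> sets (borel \<Otimes>\<^sub>M borel)"
    using A by (simp cong: sets_pair_measure_cong)
  have "emeasure (distr (gauss \<Otimes>\<^sub>M gauss) (gauss \<Otimes>\<^sub>M gauss) (rot a)) A =
      (\<integral>\<^sup>+p. indicator A (rot a p) \<partial>(gauss \<Otimes>\<^sub>M gauss))"
    by (subst nn_integral_indicator[symmetric]) (simp_all add: nn_integral_distr del: nn_integral_indicator)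
  also have "\<dots> = (\<integral>\<^sup>+x. \<integral>\<^sup>+y. indicator A (rot a (x, y)) \<partial>gauss \<partial>gauss)"
    by (rule gauss.nn_integral_fst[symmetric]) measurable
  also have "\<dots> = (\<integral>\<^sup>+x. \<integral>\<^sup>+y. indicator A (x, y) \<partial>gauss \<partial>gauss)"
    by (rule nn_integral_rot[OF _ assms]) measurable
  also have "\<dots> = (\<integral>\<^sup>+p. indicator A p \<partial>(gauss \<Otimes>\<^sub>M gauss))"
    by (rule gauss.nn_integral_fst) measurable
  finally show "emeasure (distr (gauss \<Otimes>\<^sub>M gauss) (gauss \<Otimes>\<^sub>M gauss) (rot a)) A =
      emeasure (gauss \<Otimes>\<^sub>M gauss) A"
    by simp
qed simp

lemma distr_gauss_fst: "distr (gauss \<Otimes>\<^sub>M gauss) gauss fst = gauss"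
  by (rule gauss.distr_pair_fst)

text \<open>The points \<open>a \<noteq> 1\<close> of the unit circle are left out: no \<open>exp (- t e\<^sup>i\<^sup>\<theta>)\<close> with \<open>t \<ge> 0\<close> is one of them,
  and for \<open>|a| < 1\<close> invariance under \<open>rot a\<close> needs only real dilations and translations.\<close>
definition admissible :: "complex \<Rightarrow> bool" where
  "admissible a \<longleftrightarrow> a = 1 \<or> cmod a < 1"

text \<open>For \<open>cmod a < 1\<close> the mixture is the first marginal of the rotated pair; for
  \<open>a = 1\<close> it is the first coordinate, as \<open>compl 1 = 0\<close>.\<close>

lemma distr_gauss_mix:
  assumes "admissible a"
  shows "distr (gauss \<Otimes>\<^sub>M gauss) gauss (\<lambda>(x, y). a * x + of_real (compl a) * y) = gauss"
proof (cases "a = 1")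
  case True
  then show ?thesis using distr_gauss_fst by (simp add: case_prod_beta')
next
  case False
  with assms have a: "cmod a < 1" by (simp add: admissible_def)
  have "distr (gauss \<Otimes>\<^sub>M gauss) gauss (fst \<circ> rot a) =
      distr (distr (gauss \<Otimes>\<^sub>M gauss) (gauss \<Otimes>\<^sub>M gauss) (rot a)) gauss fst"
    by (rule distr_distr[symmetric]) measurable
  also have "\<dots> = gauss"
    by (simp add: distr_rot[OF a] distr_gauss_fst)
  also have "fst \<circ> rot a = (\<lambda>(x, y). a * x + of_real (compl a) * y)"
    by (auto simp: rot_def)
  finally show ?thesis .
qed

section \<open>The Mehler kernel\<close>

definition mehler :: "complex \<Rightarrow> (complex \<Rightarrow> complex) \<Rightarrow> complex \<Rightarrow> complex" where
  "mehler a f x = (\<integral>y. f (a * x + of_real (compl a) * y) \<partial>gauss)"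

lemma measurable_gauss_iff [simp]: "borel_measurable gauss = borel_measurable borel"
  by (rule measurable_cong_sets) auto

lemma mehler_measurable [measurable]:
  assumes [measurable]: "f \<in> borel_measurable borel"
  shows "mehler a f \<in> borel_measurable borel"
proof -
  have "(\<lambda>x. \<integral>y. f (a * x + of_real (compl a) * y) \<partial>gauss) \<in> borel_measurable borel"
    by measurable
  then show ?thesis by (simp add: mehler_def[abs_def])
qed

lemma mehler_1 [simp]: "mehler 1 f = f"
  using gauss.prob_space by (simp add: mehler_def[abs_def])

lemma mehler_mult: "mehler a (\<lambda>x. c * f x) x = c * mehler a f x"
  by (simp add: mehler_def)

lemma
  fixes f :: "complex \<Rightarrow> 'b::{banach, second_countable_topology}"
  assumes "admissible a" and [measurable]: "f \<in> borel_measurable borel"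
  shows integral_mix: "(\<integral>p. f (a * fst p + of_real (compl a) * snd p) \<partial>(gauss \<Otimes>\<^sub>M gauss)) = integral\<^sup>L gauss f"
    and integrable_mix: "integrable gauss f \<Longrightarrow>
      integrable (gauss \<Otimes>\<^sub>M gauss) (\<lambda>p. f (a * fst p + of_real (compl a) * snd p))"
proof -
  have mix: "distr (gauss \<Otimes>\<^sub>M gauss) gauss (\<lambda>p. a * fst p + of_real (compl a) * snd p) = gauss"
    using distr_gauss_mix[OF assms(1)] by (simp add: case_prod_beta')
  show "(\<integral>p. f (a * fst p + of_real (compl a) * snd p) \<partial>(gauss \<Otimes>\<^sub>M gauss)) = integral\<^sup>L gauss f"
    by (subst (3) mix[symmetric], subst integral_distr) measurable
  show "integrable (gauss \<Otimes>\<^sub>M gauss) (\<lambda>p. f (a * fst p + of_real (compl a) * snd p))" if "integrable gauss f"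
    using that by (subst (asm) mix[symmetric], subst (asm) integrable_distr_eq) measurable
qed

text \<open>Fubini's theorem controls the sections only for almost every \<open>x\<close>. Elsewhere
  the integral in \<open>mehler\<close> may take its default value 0, so additivity of
  \<open>mehler a\<close> is claimed only for classes.\<close>

lemma L2_mix_AE:
  assumes "admissible a" and f: "L2 f"
  shows "AE x in gauss. L2 (\<lambda>y. f (a * x + of_real (compl a) * y))"
proof -
  have [measurable]: "f \<in> borel_measurable borel"
    using f by (rule L2_measurable)
  have "integrable (gauss \<Otimes>\<^sub>M gauss) (\<lambda>p. (cmod (f (a * fst p + of_real (compl a) * snd p)))^2)"
    by (rule integrable_mix[OF assms(1)]) (auto intro: L2_square assms)
  from gauss2.AE_integrable_fst'[OF this]
  show ?thesis
    by eventually_elim (auto intro!: L2I)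
qed

text \<open>Cauchy-Schwarz in the inner variable bounds the squared modulus of
  \<open>mehler a f x\<close> by the mean \<open>G x\<close>. By invariance of the mixture,
  \<open>G\<close> has the same integral as the squared modulus of \<open>f\<close>.\<close>

lemma
  assumes a: "admissible a" and f: "L2 f"
  shows L2_mehler: "L2 (mehler a f)"
    and mehler_contraction: "L2norm (mehler a f) \<le> L2norm f"
proof -
  have [measurable]: "f \<in> borel_measurable borel"
    using f by (rule L2_measurable)
  define G where "G x = (\<integral>y. (cmod (f (a * x + of_real (compl a) * y)))^2 \<partial>gauss)" for x
  have int: "integrable (gauss \<Otimes>\<^sub>M gauss) (\<lambda>p. (cmod (f (a * fst p + of_real (compl a) * snd p)))^2)"
    by (rule integrable_mix[OF a]) (auto intro: L2_square f)
  have iG: "integrable gauss G"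
    using gauss2.integrable_fst'[OF int] by (simp add: G_def[abs_def])
  have "(\<integral>x. G x \<partial>gauss) = (\<integral>x. (cmod (f x))^2 \<partial>gauss)"
    using gauss2.integral_fst'[OF int] integral_mix[OF a, of "\<lambda>x. (cmod (f x))^2"]
    by (simp add: G_def)
  moreover have le: "AE x in gauss. (cmod (mehler a f x))^2 \<le> G x"
    using L2_mix_AE[OF a f]
  proof eventually_elim
    case (elim x)
    have "cmod (mehler a f x) \<le> (\<integral>y. cmod (f (a * x + of_real (compl a) * y)) \<partial>gauss)"
      unfolding mehler_def by (rule integral_norm_bound)
    also have "\<dots> \<le> sqrt (G x)"
      using integral_norm_le_L2norm[OF elim] by (simp add: L2norm_def G_def)
    finally have "(cmod (mehler a f x))^2 \<le> (sqrt (G x))^2"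
      by (rule power_mono) simp
    then show ?case
      by (simp add: G_def)
  qed
  moreover show L: "L2 (mehler a f)"
    by (rule L2_bound[OF _ iG le]) measurable
  ultimately show "L2norm (mehler a f) \<le> L2norm f"
    using integral_mono_AE[OF L2_square[OF L] iG le] by (simp add: L2norm_def)
qed

lemma cls_mehler_add:
  assumes a: "admissible a" and "L2 f" "L2 g"
  shows "cls (mehler a (\<lambda>x. f x + g x)) = cls (mehler a f) + cls (mehler a g)"
proof -
  have "AE x in gauss. mehler a (\<lambda>x. f x + g x) x = mehler a f x + mehler a g x"
    using L2_mix_AE[OF a \<open>L2 f\<close>] L2_mix_AE[OF a \<open>L2 g\<close>]
    by eventually_elim (simp add: mehler_def L2_integrable)
  then show ?thesis
    using assms by (simp add: cls_eq_iff cls_add[symmetric] L2_mehler L2_add)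
qed

text \<open>The contraction bound sends the null function \<open>f - g\<close> to a null function.
  Hence the representative chosen in \<open>OU\<close> is immaterial.\<close>

lemma cls_mehler_cong:
  assumes a: "admissible a" and "L2 f" "L2 g" "cls f = cls g"
  shows "cls (mehler a f) = cls (mehler a g)"
proof -
  have d: "L2 (\<lambda>x. f x - g x)" using assms by (intro L2_diff)
  have "cls (mehler a f) = cls (mehler a (\<lambda>x. f x - g x)) + cls (mehler a g)"
    using cls_mehler_add[OF a d \<open>L2 g\<close>] by simp
  moreover have "norm (cls (mehler a (\<lambda>x. f x - g x))) \<le> norm (cls (\<lambda>x. f x - g x))"
    using mehler_contraction[OF a d] by (simp add: norm_cls L2_mehler a d)
  ultimately show ?thesis
    using assms by (simp add: cls_diff)
qed

definition OU :: "complex \<Rightarrow> l2 \<Rightarrow> l2" where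
  "OU a x = cls (mehler a (rep_l2 x))"

lemma OU_cls:
  assumes "admissible a" "L2 f"
  shows "OU a (cls f) = cls (mehler a f)"
proof -
  have "L2 (rep_l2 (cls f))"
    using Quotient_rep_reflp[OF Quotient_l2] by (simp add: L2eq_def)
  moreover have "cls (rep_l2 (cls f)) = cls f"
    by (rule Quotient_abs_rep[OF Quotient_l2])
  ultimately show ?thesis
    unfolding OU_def using assms by (intro cls_mehler_cong)
qed

lemma OU_linear:
  assumes a: "admissible a"
  shows "linear (OU a)"
proof (rule linearI)
  fix x y :: l2 and r :: real
  obtain f where f: "L2 f" "x = cls f" by (metis ex_cls)
  obtain g where g: "L2 g" "y = cls g" by (metis ex_cls)
  show "OU a (x + y) = OU a x + OU a y"
    using f g a by (simp add: cls_add[symmetric] OU_cls L2_add cls_mehler_add)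
  have "mehler a (\<lambda>x. r *\<^sub>R f x) = (\<lambda>x. r *\<^sub>R mehler a f x)"
    using mehler_mult[of a "of_real r" f] by (auto simp: scaleR_conv_of_real)
  then show "OU a (r *\<^sub>R x) = r *\<^sub>R OU a x"
    using f a by (simp add: cls_scaleR[symmetric] OU_cls L2_scaleR L2_mehler)
qed

lemma OU_contraction: "admissible a \<Longrightarrow> norm (OU a x) \<le> norm x"
  by (metis ex_cls OU_cls norm_cls L2_mehler mehler_contraction)

lemma OU_1: "OU 1 x = x"
  by (metis ex_cls OU_cls admissible_def mehler_1)

text \<open>The map \<open>rot a\<close> exchanges \<open>x\<close> with \<open>a x + s y\<close>, which turns \<open>a\<close> into \<open>cnj a\<close>.\<close>
lemma mehler_adjoint:
  assumes a: "admissible a" and f: "L2 f" and g: "L2 g"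
  shows "L2inner (mehler a f) g = L2inner f (mehler (cnj a) g)"
proof (cases "a = 1")
  case False
  have [measurable]: "f \<in> borel_measurable borel" "g \<in> borel_measurable borel"
    using f g by (auto intro: L2_measurable)
  from False a have a1: "cmod a < 1" by (simp add: admissible_def)
  define s where "s = complex_of_real (compl a)"
  define h where "h = (\<lambda>p. f (a * fst p + s * snd p) * cnj (g (fst p)))"
  define H where "H = (\<lambda>p. f (fst p) * cnj (g (cnj a * fst p + s * snd p)))"
  have [measurable]: "h \<in> borel_measurable (gauss \<Otimes>\<^sub>M gauss)" "H \<in> borel_measurable (gauss \<Otimes>\<^sub>M gauss)"
    unfolding h_def H_def by measurable
  have hH: "h p = H (rot a p)" for p
    using rot_inverse[of a "fst p" "snd p"] a1 unfolding h_def H_def rot_def s_def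
    by (simp add: case_prod_beta)
  have ih: "integrable (gauss \<Otimes>\<^sub>M gauss) h"
  proof (rule Bochner_Integration.integrable_bound)
    \<comment> \<open>The case \<open>a = 1\<close> of \<open>integrable_mix\<close>, in which the
      mixture is the first coordinate, handles \<open>g (fst p)\<close>.\<close>
    have "integrable (gauss \<Otimes>\<^sub>M gauss) (\<lambda>p. (cmod (g (1 * fst p + of_real (compl 1) * snd p)))^2)"
      by (rule integrable_mix) (auto intro: L2_square assms simp: admissible_def)
    moreover have "integrable (gauss \<Otimes>\<^sub>M gauss) (\<lambda>p. (cmod (f (a * fst p + s * snd p)))^2)"
      unfolding s_def by (rule integrable_mix[OF a]) (auto intro: L2_square assms)
    ultimately show "integrable (gauss \<Otimes>\<^sub>M gauss)
        (\<lambda>p. (cmod (f (a * fst p + s * snd p)))^2 + (cmod (g (fst p)))^2)"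
      by (intro Bochner_Integration.integrable_add) simp_all
    show "AE p in gauss \<Otimes>\<^sub>M gauss. norm (h p) \<le>
        norm ((cmod (f (a * fst p + s * snd p)))^2 + (cmod (g (fst p)))^2)"
      by (simp add: h_def cmod_mult_cnj_le)
  qed measurable
  have iH: "integrable (gauss \<Otimes>\<^sub>M gauss) H"
    using ih unfolding hH by (subst distr_rot[OF a1, symmetric], subst integrable_distr_eq) auto
  have "L2inner (mehler a f) g = (\<integral>x. \<integral>y. h (x, y) \<partial>gauss \<partial>gauss)"
    by (simp add: L2inner_def mehler_def h_def s_def)
  also have "\<dots> = (\<integral>p. h p \<partial>(gauss \<Otimes>\<^sub>M gauss))"
    by (rule gauss2.integral_fst'[OF ih])
  also have "\<dots> = (\<integral>p. H p \<partial>(gauss \<Otimes>\<^sub>M gauss))"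
    using integral_distr[OF measurable_rot, of H a] by (simp add: hH distr_rot[OF a1])
  also have "\<dots> = (\<integral>x. \<integral>y. H (x, y) \<partial>gauss \<partial>gauss)"
    by (rule gauss2.integral_fst'[OF iH, symmetric])
  also have "\<dots> = L2inner f (mehler (cnj a) g)"
    by (simp add: L2inner_def mehler_def H_def s_def)
  finally show ?thesis .
qed simp

lemma OU_adjoint:
  assumes "admissible a"
  shows "inner (OU a x) y = inner x (OU (cnj a) y)"
proof -
  have a': "admissible (cnj a)"
    using assms by (auto simp: admissible_def)
  obtain f where f: "L2 f" "x = cls f" by (metis ex_cls)
  obtain g where g: "L2 g" "y = cls g" by (metis ex_cls)
  show ?thesis
    using f g assms a' by (simp add: OU_cls inner_cls L2_mehler mehler_adjoint)
qed

section \<open>Density of bounded continuous functions\<close>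

lemma tendsto_cls_dominated:
  assumes [measurable]: "\<And>n. F n \<in> borel_measurable borel" "f \<in> borel_measurable borel"
    and lim: "\<And>x. (\<lambda>n. F n x) \<longlonglongrightarrow> f x"
    and bound: "\<And>n x. cmod (F n x) \<le> w x"
    and w: "integrable gauss (\<lambda>x. (w x)^2)"
  shows "\<And>n. L2 (F n)" "L2 f" "(\<lambda>n. cls (F n)) \<longlonglongrightarrow> cls f"
proof -
  have bound': "cmod (f x) \<le> w x" for x
    by (rule LIMSEQ_le_const2[OF tendsto_norm[OF lim]]) (use bound in blast)
  show L: "L2 (F n)" for n
    by (rule L2_bound[OF _ w]) (auto intro!: power_mono bound)
  show f: "L2 f"
    by (rule L2_bound[OF _ w]) (auto intro!: power_mono bound')
  have "(\<lambda>n. \<integral>x. (cmod (F n x - f x))^2 \<partial>gauss) \<longlonglongrightarrow> (\<integral>x. 0 \<partial>gauss)"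
  proof (rule integral_dominated_convergence)
    show "integrable gauss (\<lambda>x. 4 * (w x)^2)"
      using w by simp
    show "AE x in gauss. (\<lambda>n. (cmod (F n x - f x))^2) \<longlonglongrightarrow> 0"
      using lim by (auto intro!: always_eventually tendsto_eq_intros)
    have "(cmod (F n x - f x))^2 \<le> (2 * w x)^2" for n x
      using norm_triangle_ineq4[of "F n x" "f x"] bound[of n x] bound'[of x]
      by (intro power_mono) auto
    then show "AE x in gauss. norm ((cmod (F n x - f x))^2) \<le> 4 * (w x)^2" for n
      by (auto simp: power_mult_distrib)
  qed measurable
  then have "(\<lambda>n. sqrt (\<integral>x. (cmod (F n x - f x))^2 \<partial>gauss)) \<longlonglongrightarrow> 0"
    using tendsto_real_sqrt by fastforce
  then have "(\<lambda>n. norm (cls (F n) - cls f)) \<longlonglongrightarrow> 0"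
    by (simp add: norm_cls_diff L f L2norm_def)
  then show "(\<lambda>n. cls (F n)) \<longlonglongrightarrow> cls f"
    by (rule LIM_zero_cancel[OF tendsto_norm_zero_cancel])
qed

lemma Cb_measurable: "Cb \<phi> \<Longrightarrow> \<phi> \<in> borel_measurable borel"
  by (simp add: Cb_def borel_measurable_continuous_onI)

lemma Cb_bounded: "Cb \<phi> \<Longrightarrow> \<exists>B. \<forall>x. cmod (\<phi> x) \<le> B"
  by (auto simp: Cb_def bounded_iff)

lemma L2_Cb: "Cb \<phi> \<Longrightarrow> L2 \<phi>"
  using Cb_bounded Cb_measurable L2_bounded by metis

lemma subspace_cls_Cb: "subspace (cls ` Collect Cb)"
proof (rule subspaceI)
  have "Cb (\<lambda>_. 0)"
    by (simp add: Cb_def)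
  then show "0 \<in> cls ` Collect Cb"
    by (metis cls_zero imageI mem_Collect_eq)
next
  fix x y assume "x \<in> cls ` Collect Cb" "y \<in> cls ` Collect Cb"
  then obtain f g where fg: "Cb f" "Cb g" "x = cls f" "y = cls g" by auto
  then have "Cb (\<lambda>x. f x + g x)"
    by (auto simp: Cb_def intro!: continuous_on_add bounded_plus_comp)
  with fg show "x + y \<in> cls ` Collect Cb"
    by (auto simp: cls_add[symmetric] L2_Cb)
next
  fix x and r :: real assume "x \<in> cls ` Collect Cb"
  then obtain f where f: "Cb f" "x = cls f" by auto
  then have "Cb (\<lambda>x. r *\<^sub>R f x)"
    by (auto simp: Cb_def intro!: continuous_on_scaleR bounded_scaleR_comp)
  with f show "r *\<^sub>R x \<in> cls ` Collect Cb"
    by (auto simp: cls_scaleR[symmetric] L2_Cb)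
qed

lemma L2_indicator:
  assumes [measurable]: "A \<in> sets borel"
  shows "L2 (\<lambda>x. indicator A x * c)"
  by (rule L2_bounded[of _ "cmod c"]) (auto simp: norm_mult indicator_def)

lemma cls_indicator_compact:
  fixes K :: "complex set"
  assumes "compact K"
  shows "cls (\<lambda>x. indicator K x * c) \<in> closure (cls ` Collect Cb)"
\<comment> \<open>The distance to the empty set is 0 by convention, so the cutoffs
  \<open>F n\<close> below would be constantly \<open>c\<close> in this case.\<close>
proof (cases "K = {}")
  case True
  then show ?thesis
    using subsetD[OF closure_subset subspace_0[OF subspace_cls_Cb]] by (simp add: cls_zero)
next
  case False
  have K: "closed K" using assms by (rule compact_imp_closed)
  \<comment> \<open>Cutoffs that equal \<open>c\<close> on \<open>K\<close> and, for positive
    \<open>n\<close>, vanish at distance \<open>1 / n\<close> or more. As \<open>K\<close> is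
    closed, they tend pointwise to the indicator times \<open>c\<close>.\<close>
  define F where "F n x = complex_of_real (max 0 (1 - real n * infdist x K)) * c" for n x
  have cont: "continuous_on UNIV (F n)" for n
    unfolding F_def by (intro continuous_intros)
  have bd: "cmod (F n x) \<le> cmod c" for n x
    using infdist_nonneg[of x K] by (auto simp: F_def norm_mult intro!: mult_left_le_one_le)
  have "Cb (F n)" for n
    using cont bd by (auto simp: Cb_def bounded_iff)
  moreover have "(\<lambda>n. cls (F n)) \<longlonglongrightarrow> cls (\<lambda>x. indicator K x * c)"
  proof (rule tendsto_cls_dominated(3))
    show "F n \<in> borel_measurable borel" for n
      using cont by (rule borel_measurable_continuous_onI)
    show "(\<lambda>x. indicator K x * c) \<in> borel_measurable borel"
      using borel_closed[OF K] by measurable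
    show "(\<lambda>n. F n x) \<longlonglongrightarrow> indicator K x * c" for x
    proof (cases "x \<in> K")
      case True
      then show ?thesis by (simp add: F_def)
    next
      case False
      then have pos: "infdist x K > 0"
        using K \<open>K \<noteq> {}\<close> in_closed_iff_infdist_zero infdist_nonneg[of x K] by (metis less_eq_real_def)
      obtain N where N: "1 / infdist x K < real N"
        using reals_Archimedean2 by blast
      have "F n x = 0" if "n \<ge> N" for n
      proof -
        have "1 / infdist x K < real n" using N that by linarith
        then show ?thesis using pos by (simp add: F_def field_simps)
      qed
      then have "\<forall>\<^sub>F n in sequentially. F n x = 0"
        by (auto simp: eventually_sequentially)
      with False show ?thesis
        by (simp add: tendsto_eventually)
    qed
    show "cmod (F n x) \<le> cmod c" for n x by (rule bd)
    show "integrable gauss (\<lambda>x. (cmod c)^2)" by simp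
  qed
  ultimately show ?thesis
    unfolding closure_sequential by (intro exI[of _ "\<lambda>n. cls (F n)"]) auto
qed

lemma cls_indicator_borel:
  fixes B :: "complex set"
  assumes B [measurable]: "B \<in> sets borel"
  shows "cls (\<lambda>x. indicator B x * c) \<in> closure (cls ` Collect Cb)"
proof -
  have "\<exists>y\<in>closure (cls ` Collect Cb). dist y (cls (\<lambda>x. indicator B x * c)) < e" if e: "e > 0" for e
  proof -
    \<comment> \<open>The two classes will differ by \<open>cmod c\<close> times the square root of
      \<open>measure gauss (B - K)\<close>. The summand 1 keeps the quotient meaningful for
      \<open>c = 0\<close> and makes the final inequality strict.\<close>
    define d where "d = (e / (cmod c + 1))^2"
    have d: "d > 0" using e by (simp add: d_def add_nonneg_eq_0_iff)
    obtain K where K: "K \<subseteq> B" "compact K" "measure gauss B - measure gauss K < d"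
    \<comment> \<open>The split keeps \<open>measure gauss B - d\<close> nonnegative in the second
      case, since \<open>ennreal\<close> truncates negative numbers.\<close>
    proof (cases "measure gauss B < d")
      case True
      then show ?thesis by (intro that[of "{}"]) auto
    next
      case False
      have "ennreal (measure gauss B - d) < emeasure gauss B"
        using d False by (simp add: gauss.emeasure_eq_measure ennreal_less_iff)
      also have "\<dots> = (SUP K \<in> {K. K \<subseteq> B \<and> compact K}. emeasure gauss K)"
        by (rule inner_regular) (auto simp: gauss.emeasure_eq_measure)
      finally obtain K where "K \<subseteq> B" "compact K" "ennreal (measure gauss B - d) < emeasure gauss K"
        by (auto simp: less_SUP_iff)
      then show ?thesis
        using False by (intro that[of K]) (auto simp: gauss.emeasure_eq_measure ennreal_less_iff)
    qed
    have [measurable]: "K \<in> sets borel" using K(2) by (simp add: compact_imp_closed)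
    have "(cmod (indicator K x * c - indicator B x * c))^2 = (cmod c)^2 * indicator (B - K) x" for x
      using K(1) by (auto simp: indicator_def)
    then have "(\<integral>x. (cmod (indicator K x * c - indicator B x * c))^2 \<partial>gauss) = (cmod c)^2 * measure gauss (B - K)"
      by simp
    also have "measure gauss (B - K) = measure gauss B - measure gauss K"
      by (rule gauss.finite_measure_Diff) (use K in auto)
    finally have "norm (cls (\<lambda>x. indicator K x * c) - cls (\<lambda>x. indicator B x * c)) =
        sqrt ((cmod c)^2 * (measure gauss B - measure gauss K))"
      by (simp add: norm_cls_diff L2_indicator L2norm_def)
    also have "\<dots> \<le> sqrt ((cmod c)^2 * d)"
      using K(3) by (intro real_sqrt_le_mono mult_left_mono) auto
    also have "\<dots> = cmod c * (e / (cmod c + 1))"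
      using e by (simp add: d_def real_sqrt_mult)
    also have "\<dots> < e"
      using e norm_ge_zero[of c]
      by (auto simp: divide_less_eq algebra_simps simp del: norm_ge_zero)
    finally show ?thesis
      using cls_indicator_compact[OF K(2), of c] by (auto simp: dist_norm)
  qed
  then show ?thesis
    using closed_approachable[OF closed_closure] by blast
qed

lemma cls_Cb_dense: "closure (cls ` Collect Cb) = UNIV"
proof -
  let ?V = "closure (cls ` Collect Cb)"
  have V_0: "0 \<in> ?V"
    by (rule subsetD[OF closure_subset subspace_0[OF subspace_cls_Cb]])
  have V_add: "x + y \<in> ?V" if xy: "x \<in> ?V" "y \<in> ?V" for x y
  proof -
    obtain X Y where "\<And>n. X n \<in> cls ` Collect Cb" "X \<longlonglongrightarrow> x"
      "\<And>n. Y n \<in> cls ` Collect Cb" "Y \<longlonglongrightarrow> y"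
      using xy unfolding closure_sequential by metis
    then show ?thesis
      unfolding closure_sequential
      by (intro exI[of _ "\<lambda>n. X n + Y n"])
         (auto intro!: tendsto_add subspace_add[OF subspace_cls_Cb])
  qed
  have simple: "cls s \<in> ?V" if s: "simple_function gauss s" for s
  proof -
    have fin: "finite (range s)"
      using s by (simp add: simple_function_def)
    have meas: "s -` {y} \<in> sets borel" for y
      using measurable_sets[OF borel_measurable_simple_function[OF s], of "{y}"] by simp
    have "L2 (\<lambda>x. \<Sum>y\<in>S. indicator (s -` {y}) x * y) \<and>
        cls (\<lambda>x. \<Sum>y\<in>S. indicator (s -` {y}) x * y) \<in> ?V" if "finite S" for S
      using that
    proof induction
      case empty
      then show ?case
        using V_0 by (simp add: cls_zero)
    next
      case (insert y S)
      have L: "L2 (\<lambda>x. indicator (s -` {y}) x * y)"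
        by (rule L2_indicator[OF meas])
      show ?case
        unfolding sum.insert[OF insert.hyps] cls_add[OF L conjunct1[OF insert.IH]]
        using L2_add[OF L conjunct1[OF insert.IH]]
          V_add[OF cls_indicator_borel[OF meas] conjunct2[OF insert.IH]] by (rule conjI)
    qed
    from this[OF fin] have "cls (\<lambda>x. \<Sum>y\<in>range s. indicator (s -` {y}) x * y) \<in> ?V" ..
    also have "(\<lambda>x. \<Sum>y\<in>range s. indicator (s -` {y}) x * y) = s"
    proof
      fix x
      have "(\<Sum>y\<in>range s. indicator (s -` {y}) x * y) = (\<Sum>y\<in>range s. if y = s x then y else 0)"
        by (intro sum.cong) (auto simp: indicator_def)
      then show "(\<Sum>y\<in>range s. indicator (s -` {y}) x * y) = s x"
        using fin by simp
    qed
    finally show ?thesis .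
  qed
  have "x \<in> ?V" for x
  proof -
    obtain f where f: "L2 f" "x = cls f" by (metis ex_cls)
    then have "f \<in> borel_measurable gauss" by (simp add: L2_def)
    \<comment> \<open>The base point 0 gives simple functions dominated by
      \<open>2 * cmod (f x)\<close>, as convergence in norm requires.\<close>
    from borel_measurable_implies_sequence_metric[OF this, of 0] obtain F where
      F: "\<And>i. simple_function gauss (F i)" "\<And>x. (\<lambda>i. F i x) \<longlonglongrightarrow> f x"
      "\<And>i x. cmod (F i x) \<le> 2 * cmod (f x)"
      by auto
    have "(\<lambda>i. cls (F i)) \<longlonglongrightarrow> cls f"
    proof (rule tendsto_cls_dominated(3))
      show "F i \<in> borel_measurable borel" for i
        using borel_measurable_simple_function[OF F(1)] by simp
      show "f \<in> borel_measurable borel"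
        using f by (simp add: L2_measurable)
      show "integrable gauss (\<lambda>x. (2 * cmod (f x))^2)"
        using L2_square[OF f(1)] by (simp add: power_mult_distrib)
    qed (rule F)+
    then show ?thesis
      unfolding f by (rule closed_sequentially[OF closed_closure simple[OF F(1)]])
  qed
  then show ?thesis by blast
qed

section \<open>Semigroup law and strong continuity\<close>

lemma eq_on_dense_Cb:
  fixes S T :: "l2 \<Rightarrow> l2"
  assumes "continuous_on UNIV S" "continuous_on UNIV T"
    and "\<And>\<phi>. Cb \<phi> \<Longrightarrow> S (cls \<phi>) = T (cls \<phi>)"
  shows "S x = T x"
proof -
  have "closed {x. S x = T x}"
    using assms by (intro closed_Collect_eq)
  then have "closure (cls ` Collect Cb) \<subseteq> {x. S x = T x}"
    using assms(3) by (intro closure_minimal) auto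
  then show ?thesis
    by (auto simp: cls_Cb_dense)
qed

lemma OU_continuous: "admissible a \<Longrightarrow> continuous_on UNIV (OU a)"
  by (rule linear_continuous_on)
     (use OU_linear OU_contraction in \<open>auto simp: bounded_linear_def bounded_linear_axioms_def intro!: exI[of _ 1]\<close>)

lemma cmod_mult_less_1:
  assumes "cmod a < 1" "cmod b < 1"
  shows "cmod (a * b) < 1"
  using mult_strict_mono[of "cmod a" 1 "cmod b" 1] assms by (simp add: norm_mult)

lemma admissible_mult: "admissible a \<Longrightarrow> admissible b \<Longrightarrow> admissible (a * b)"
  using cmod_mult_less_1[of a b] by (auto simp: admissible_def)

text \<open>The sum of the independent Gaussians \<open>b s\<^sub>a y\<close> and \<open>s\<^sub>b z\<close> is distributed as
  \<open>s\<^sub>a\<^sub>b\<close> times a single one.\<close>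
lemma mehler_mehler:
  assumes a: "admissible a" and b: "admissible b" and \<phi>: "Cb \<phi>"
  shows "mehler a (mehler b \<phi>) x = mehler (a * b) \<phi> x"
proof (cases "a = 1 \<or> b = 1")
  case False
  with a b have a1: "cmod a < 1" and b1: "cmod b < 1" by (auto simp: admissible_def)
  have ab1: "cmod (a * b) < 1"
    using a1 b1 by (rule cmod_mult_less_1)
  define \<sigma> where "\<sigma> = compl (a * b)"
  have \<sigma>: "\<sigma> > 0" using ab1 by (simp add: \<sigma>_def compl_pos)
  \<comment> \<open>With this choice \<open>\<sigma> * \<alpha>\<close> is the coefficient of
    \<open>y\<close> and \<open>\<sigma> * compl \<alpha> = compl b\<close> that of
    \<open>z\<close>, so the two noise terms are \<open>\<sigma>\<close> times one mixture, to which
    \<open>integral_mix\<close> applies.\<close>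
  define \<alpha> where "\<alpha> = b * of_real (compl a / \<sigma>)"
  have "(cmod \<alpha>)\<^sup>2 = (cmod b)\<^sup>2 * (compl a)\<^sup>2 / \<sigma>\<^sup>2"
    by (simp add: \<alpha>_def norm_mult norm_divide power_mult_distrib power_divide)
  also have "(cmod b)\<^sup>2 * (compl a)\<^sup>2 = \<sigma>\<^sup>2 - (compl b)\<^sup>2"
    using a1 b1 ab1 by (simp add: \<sigma>_def compl_square norm_mult power_mult_distrib algebra_simps)
  finally have \<alpha>: "1 - (cmod \<alpha>)\<^sup>2 = (compl b / \<sigma>)\<^sup>2"
    using \<sigma> by (simp add: power_divide field_simps)
  have "(compl b / \<sigma>)\<^sup>2 > 0"
    using \<sigma> compl_pos[OF b1] by simp
  then have "(cmod \<alpha>)\<^sup>2 < 1"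
    using \<alpha> by linarith
  then have adm: "admissible \<alpha>"
    by (simp add: admissible_def abs_square_less_1)
  have compl_\<alpha>: "compl \<alpha> = compl b / \<sigma>"
    unfolding compl_def[of \<alpha>] \<alpha> using \<sigma> compl_pos[OF b1] by simp
  obtain B where B: "\<And>x. cmod (\<phi> x) \<le> B" using Cb_bounded[OF \<phi>] by blast
  have [measurable]: "\<phi> \<in> borel_measurable borel" using Cb_measurable[OF \<phi>] .
  define \<psi> where "\<psi> w = \<phi> (a * b * x + of_real \<sigma> * w)" for w
  have [measurable]: "\<psi> \<in> borel_measurable borel"
    unfolding \<psi>_def by measurable
  have i\<psi>: "integrable gauss \<psi>"
    by (rule gauss.integrable_const_bound[of _ B]) (auto simp: \<psi>_def B)
  have "mehler a (mehler b \<phi>) x = (\<integral>y. \<integral>z. \<psi> (\<alpha> * fst (y, z) + of_real (compl \<alpha>) * snd (y, z)) \<partial>gauss \<partial>gauss)"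
    unfolding mehler_def \<psi>_def compl_\<alpha> unfolding \<alpha>_def using \<sigma>
    by (intro Bochner_Integration.integral_cong refl arg_cong[where f = \<phi>]) (simp add: field_simps)
  also have "\<dots> = (\<integral>p. \<psi> (\<alpha> * fst p + of_real (compl \<alpha>) * snd p) \<partial>(gauss \<Otimes>\<^sub>M gauss))"
    by (rule gauss2.integral_fst'[OF integrable_mix[OF adm _ i\<psi>]]) measurable
  also have "\<dots> = (\<integral>w. \<psi> w \<partial>gauss)"
    by (rule integral_mix[OF adm]) measurable
  also have "\<dots> = mehler (a * b) \<phi> x"
    by (simp add: mehler_def \<psi>_def \<sigma>_def)
  finally show ?thesis .
qed auto

text \<open>On \<open>Cb\<close> the composition law holds at every point, since bounded integrands
  are integrable; density and continuity carry it to all classes.\<close>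

lemma OU_OU:
  assumes a: "admissible a" and b: "admissible b"
  shows "OU a (OU b x) = OU (a * b) x"
proof (rule eq_on_dense_Cb[where S = "\<lambda>x. OU a (OU b x)" and T = "OU (a * b)"])
  show "continuous_on UNIV (\<lambda>x. OU a (OU b x))"
    using OU_continuous[OF a] OU_continuous[OF b] by (rule continuous_on_compose2) auto
  show "continuous_on UNIV (OU (a * b))"
    by (rule OU_continuous[OF admissible_mult[OF a b]])
  show "OU a (OU b (cls \<phi>)) = OU (a * b) (cls \<phi>)" if \<phi>: "Cb \<phi>" for \<phi>
  proof -
    have "mehler a (mehler b \<phi>) = mehler (a * b) \<phi>"
      using mehler_mehler[OF a b \<phi>] by auto
    then show ?thesis
      using a b L2_Cb[OF \<phi>] by (simp add: OU_cls L2_mehler admissible_mult)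
  qed
qed

lemma mehler_tendsto:
  assumes lim: "a \<longlonglongrightarrow> 1" and \<phi>: "Cb \<phi>"
  shows "(\<lambda>n. mehler (a n) \<phi> x) \<longlonglongrightarrow> \<phi> x"
proof -
  obtain B where B: "\<And>x. cmod (\<phi> x) \<le> B" using Cb_bounded[OF \<phi>] by blast
  have [measurable]: "\<phi> \<in> borel_measurable borel" using Cb_measurable[OF \<phi>] .
  have "(\<lambda>n. \<integral>y. \<phi> (a n * x + of_real (compl (a n)) * y) \<partial>gauss) \<longlonglongrightarrow> (\<integral>y. \<phi> x \<partial>gauss)"
  proof (rule integral_dominated_convergence[where w = "\<lambda>_. B"])
    have "(\<lambda>n. a n * x + of_real (compl (a n)) * y) \<longlonglongrightarrow> 1 * x + of_real (sqrt (1 - (cmod 1)\<^sup>2)) * y" for y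
      unfolding compl_def by (intro tendsto_intros lim)
    moreover have "isCont \<phi> x"
      using \<phi> by (auto simp: Cb_def continuous_on_eq_continuous_at)
    ultimately have "(\<lambda>n. \<phi> (a n * x + of_real (compl (a n)) * y)) \<longlonglongrightarrow> \<phi> x" for y
      by (intro isCont_tendsto_compose[where g = \<phi>]) auto
    then show "AE y in gauss. (\<lambda>n. \<phi> (a n * x + of_real (compl (a n)) * y)) \<longlonglongrightarrow> \<phi> x"
      by simp
  qed (auto simp: B)
  then show ?thesis
    using gauss.prob_space by (simp add: mehler_def)
qed

text \<open>Convergence on the dense set of classes from \<open>Cb\<close> extends to
  \<open>l2\<close> because all operators have norm at most 1. Sequences of parameters appear
  because the limit on \<open>Cb\<close> comes from dominated convergence.\<close>

lemma OU_tendsto: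
  assumes adm: "\<And>n. admissible (a n)" and lim: "a \<longlonglongrightarrow> 1"
  shows "(\<lambda>n. OU (a n) x) \<longlonglongrightarrow> x"
proof -
  have Cb: "(\<lambda>n. OU (a n) (cls \<phi>)) \<longlonglongrightarrow> cls \<phi>" if \<phi>: "Cb \<phi>" for \<phi>
  proof -
    obtain B where B: "\<And>x. cmod (\<phi> x) \<le> B" using Cb_bounded[OF \<phi>] by blast
    have [measurable]: "\<phi> \<in> borel_measurable borel" using Cb_measurable[OF \<phi>] .
    have "(\<lambda>n. cls (mehler (a n) \<phi>)) \<longlonglongrightarrow> cls \<phi>"
    proof (rule tendsto_cls_dominated(3))
      show "cmod (mehler (a n) \<phi> x) \<le> B" for n x
      proof -
        have "cmod (mehler (a n) \<phi> x) \<le> (\<integral>y. cmod (\<phi> (a n * x + of_real (compl (a n)) * y)) \<partial>gauss)"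
          unfolding mehler_def by (rule integral_norm_bound)
        also have "\<dots> \<le> B"
          by (rule gauss.integral_le_const) (auto simp: B intro!: gauss.integrable_const_bound[of _ B])
        finally show ?thesis .
      qed
    qed (auto intro: mehler_tendsto[OF lim \<phi>])
    then show ?thesis
      using adm L2_Cb[OF \<phi>] by (simp add: OU_cls)
  qed
  show ?thesis
  proof (rule LIMSEQ_I)
    fix e :: real assume e: "e > 0"
    have "x \<in> closure (cls ` Collect Cb)" by (simp add: cls_Cb_dense)
    then obtain \<phi> where \<phi>: "Cb \<phi>" "dist (cls \<phi>) x < e / 3"
      using e unfolding closure_approachable by (metis (no_types, lifting) divide_pos_pos imageE mem_Collect_eq zero_less_numeral)
    from LIMSEQ_D[OF Cb[OF \<phi>(1)], of "e / 3"] e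
    obtain N where N: "\<And>n. n \<ge> N \<Longrightarrow> norm (OU (a n) (cls \<phi>) - cls \<phi>) < e / 3" by auto
    have "norm (OU (a n) x - x) < e" if "n \<ge> N" for n
    proof -
      have "OU (a n) x - x = OU (a n) (x - cls \<phi>) + (OU (a n) (cls \<phi>) - cls \<phi>) + (cls \<phi> - x)"
        by (simp add: linear_diff[OF OU_linear[OF adm]])
      also have "norm \<dots> \<le> norm (OU (a n) (x - cls \<phi>)) + norm (OU (a n) (cls \<phi>) - cls \<phi>) + norm (cls \<phi> - x)"
        by (intro order_trans[OF norm_triangle_ineq] add_mono order_refl)
      also have "\<dots> < e / 3 + e / 3 + e / 3"
        using N[OF that] \<phi>(2) OU_contraction[OF adm, of n "x - cls \<phi>"]
        by (simp add: dist_norm norm_minus_commute)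
      finally show ?thesis by simp
    qed
    then show "\<exists>N. \<forall>n\<ge>N. norm (OU (a n) x - x) < e" by blast
  qed
qed

section \<open>Normality\<close>

lift_definition imul :: "l2 \<Rightarrow> l2" is "\<lambda>f x. \<i> * f x"
  by (auto simp: L2eq_def L2_mult)

lemma imul_cls: "L2 f \<Longrightarrow> imul (cls f) = cls (\<lambda>x. \<i> * f x)"
  by (simp add: imul.abs_eq L2eq_def)

lemma OU_imul:
  assumes "admissible a"
  shows "OU a (imul x) = imul (OU a x)"
proof -
  obtain f where f: "L2 f" "x = cls f" by (metis ex_cls)
  have "mehler a (\<lambda>x. \<i> * f x) = (\<lambda>x. \<i> * mehler a f x)"
    using mehler_mult[of a \<i> f] by auto
  then show ?thesis
    using f assms by (simp add: imul_cls OU_cls L2_mult L2_mehler)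
qed

lemma bounded_linear_imul: "bounded_linear imul"
proof (rule bounded_linear_intro[of _ 1])
  fix x y :: l2 and r :: real
  obtain f where f: "L2 f" "x = cls f" by (metis ex_cls)
  obtain g where g: "L2 g" "y = cls g" by (metis ex_cls)
  show "imul (x + y) = imul x + imul y"
    using f g by (simp add: cls_add[symmetric] imul_cls L2_add L2_mult distrib_left)
  show "imul (r *\<^sub>R x) = r *\<^sub>R imul x"
    using f by (simp add: cls_scaleR[symmetric] imul_cls L2_scaleR L2_mult)
  show "norm (imul x) \<le> norm x * 1"
    using f by (simp add: imul_cls norm_cls L2_mult) (simp add: L2norm_def norm_mult)
qed

text \<open>The imaginary part of \<open>L2inner f g\<close> is minus the real part for
  \<open>\<i> * f\<close> and \<open>g\<close>, so real inner products determine the complex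
  one.\<close>

lemma L2inner_eq_iff:
  assumes "L2 f" "L2 g" "L2 f'" "L2 g'"
  shows "L2inner f g = L2inner f' g' \<longleftrightarrow>
    inner (cls f) (cls g) = inner (cls f') (cls g') \<and>
    inner (imul (cls f)) (cls g) = inner (imul (cls f')) (cls g')"
proof -
  have "Re (L2inner (\<lambda>x. \<i> * f x) g) = - Im (L2inner f g)" for f g
    by (simp add: L2inner_def mult.assoc)
  then show ?thesis
    using assms by (simp add: imul_cls inner_cls L2_mult complex_eq_iff)
qed

text \<open>\<open>D'\<close> and \<open>N'\<close> are the operator induced on classes. The
  assumption \<open>D\<close> also says that membership in the domain ignores null sets;
  \<open>imul\<close> makes the real adjoint condition equivalent to the complex one;
  \<open>adj\<close> and \<open>adj_dom\<close> are the two inclusions between the domains of the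
  operator and its adjoint.\<close>

lemma normal_opI:
  fixes D' :: "l2 set" and N' :: "l2 \<Rightarrow> l2"
  assumes D: "\<And>f. f \<in> D \<longleftrightarrow> L2 f \<and> cls f \<in> D'"
    and N: "\<And>f. f \<in> D \<Longrightarrow> L2 (N f) \<and> cls (N f) = N' (cls f)"
    and imul: "\<And>x. x \<in> D' \<Longrightarrow> imul x \<in> D' \<and> N' (imul x) = imul (N' x)"
    and dense: "\<And>x e. e > 0 \<Longrightarrow> \<exists>y\<in>D'. norm (x - y) < e"
    and closed: "\<And>xs x h. (\<And>n. xs n \<in> D') \<Longrightarrow> xs \<longlonglongrightarrow> x \<Longrightarrow> (\<lambda>n. N' (xs n)) \<longlonglongrightarrow> h \<Longrightarrow>
        x \<in> D' \<and> N' x = h"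
    and adj: "\<And>y. y \<in> D' \<Longrightarrow> \<exists>k. norm k = norm (N' y) \<and> (\<forall>x\<in>D'. inner (N' x) y = inner x k)"
    and adj_dom: "\<And>y k. (\<And>x. x \<in> D' \<Longrightarrow> inner (N' x) y = inner x k) \<Longrightarrow> y \<in> D'"
  shows "normal_op D N"
proof -
  have adjoint_iff: "(\<forall>f\<in>D. L2inner (N f) g = L2inner f h) \<longleftrightarrow>
      (\<forall>x\<in>D'. inner (N' x) (cls g) = inner x (cls h))" if "L2 g" "L2 h" for g h
  proof
    assume *: "\<forall>f\<in>D. L2inner (N f) g = L2inner f h"
    show "\<forall>x\<in>D'. inner (N' x) (cls g) = inner x (cls h)"
    proof
      fix x assume x: "x \<in> D'"
      obtain f where f: "L2 f" "x = cls f" by (metis ex_cls)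
      with x have "f \<in> D" by (simp add: D)
      with * N[OF this] f that show "inner (N' x) (cls g) = inner x (cls h)"
        by (auto simp: L2inner_eq_iff)
    qed
  next
    assume *: "\<forall>x\<in>D'. inner (N' x) (cls g) = inner x (cls h)"
    show "\<forall>f\<in>D. L2inner (N f) g = L2inner f h"
    proof
      fix f assume f: "f \<in> D"
      then have "L2 f" "cls f \<in> D'" by (auto simp: D)
      \<comment> \<open>The hypothesis at \<open>cls f\<close> gives the real parts, at
        \<open>imul (cls f)\<close> the imaginary parts.\<close>
      with * N[OF f] that imul[of "cls f"] show "L2inner (N f) g = L2inner f h"
        by (simp add: L2inner_eq_iff) metis
    qed
  qed
  \<comment> \<open>Density of the domain makes the adjoint vector unique as a class, so the
    function that \<open>SOME\<close> selects has the norm supplied by the assumption on adjoint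
    vectors.\<close>
  have unique: "h = k" if "\<forall>x\<in>D'. inner x h = inner x k" for h k
  proof (rule ccontr)
    assume "h \<noteq> k"
    then have pos: "norm (h - k) > 0" by simp
    from dense[OF this] obtain y where y: "y \<in> D'" "norm ((h - k) - y) < norm (h - k)" by blast
    have "(norm (h - k))\<^sup>2 = inner ((h - k) - y) (h - k)"
      using that y(1) by (simp add: power2_norm_eq_inner inner_diff)
    also have "\<dots> \<le> norm ((h - k) - y) * norm (h - k)"
      by (rule norm_cauchy_schwarz)
    also have "\<dots> < (norm (h - k))\<^sup>2"
      using y(2) pos by (simp add: power2_eq_square)
    finally show False by simp
  qed
  show ?thesis
    unfolding normal_op_def
  proof (intro conjI allI ballI impI)
    show "D \<subseteq> {f. L2 f}" by (auto simp: D)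
    show "L2 (N f)" if "f \<in> D" for f using N[OF that] by simp
    show "\<exists>g\<in>D. L2norm (\<lambda>x. f x - g x) < e" if f: "L2 f" and e: "e > 0" for f e
    proof -
      obtain y where y: "y \<in> D'" "norm (cls f - y) < e" using dense[OF e] by blast
      obtain g where "L2 g" "y = cls g" by (metis ex_cls)
      with y f show ?thesis by (auto simp: D norm_cls_diff intro!: bexI[of _ g])
    qed
    fix fs f h
    assume *: "(\<forall>n. fs n \<in> D) \<and> L2 f \<and> L2 h \<and>
         (\<lambda>n. L2norm (\<lambda>x. fs n x - f x)) \<longlonglongrightarrow> 0 \<and>
         (\<lambda>n. L2norm (\<lambda>x. N (fs n) x - h x)) \<longlonglongrightarrow> 0"
    then have fs: "L2 (fs n)" "cls (fs n) \<in> D'" "L2 (N (fs n))" "cls (N (fs n)) = N' (cls (fs n))" for n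
      using N by (auto simp: D)
    have "(\<lambda>n. norm (cls (fs n) - cls f)) \<longlonglongrightarrow> 0" "(\<lambda>n. norm (N' (cls (fs n)) - cls h)) \<longlonglongrightarrow> 0"
      using * fs by (simp_all add: norm_cls_diff flip: fs(4))
    then have "(\<lambda>n. cls (fs n)) \<longlonglongrightarrow> cls f" "(\<lambda>n. N' (cls (fs n))) \<longlonglongrightarrow> cls h"
      by (blast intro: LIM_zero_cancel tendsto_norm_zero_cancel)+
    from closed[OF fs(2) this] have lim: "cls f \<in> D'" "N' (cls f) = cls h" by auto
    then show f: "f \<in> D" using * by (simp add: D)
    show "L2norm (\<lambda>x. N f x - h x) = 0"
      using N[OF f] lim * by (simp flip: norm_cls_diff)
  next
    show "adj_dom D N = D"
    proof (intro set_eqI iffI)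
      fix g assume "g \<in> adj_dom D N"
      then obtain h where "L2 g" "L2 h" "\<forall>f\<in>D. L2inner (N f) g = L2inner f h"
        by (auto simp: adj_dom_def)
      with adjoint_iff adj_dom[of "cls g" "cls h"] show "g \<in> D" by (simp add: D)
    next
      fix g assume "g \<in> D"
      then have g: "L2 g" "cls g \<in> D'" by (auto simp: D)
      from adj[OF g(2)] obtain k where k: "\<forall>x\<in>D'. inner (N' x) (cls g) = inner x k" by blast
      obtain h where "L2 h" "k = cls h" by (metis ex_cls)
      with g k adjoint_iff[of g h] show "g \<in> adj_dom D N"
        by (auto simp: adj_dom_def)
    qed
  next
    fix g assume gD: "g \<in> D"
    then have g: "L2 g" "cls g \<in> D'" by (auto simp: D)
    from adj[OF g(2)] obtain k where
      k: "norm k = norm (N' (cls g))" "\<forall>x\<in>D'. inner (N' x) (cls g) = inner x k" by blast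
    obtain h where h: "L2 h" "k = cls h" by (metis ex_cls)
    have "L2 h \<and> (\<forall>f\<in>D. L2inner (N f) g = L2inner f h)"
      using g h k adjoint_iff by simp
    then have A: "L2 (adj D N g) \<and> (\<forall>f\<in>D. L2inner (N f) g = L2inner f (adj D N g))"
      unfolding adj_def
      by (rule someI[where P = "\<lambda>h. L2 h \<and> (\<forall>f\<in>D. L2inner (N f) g = L2inner f h)"])
    then have "\<forall>x\<in>D'. inner (N' x) (cls g) = inner x (cls (adj D N g))"
      using adjoint_iff[of g "adj D N g"] g by simp
    with k have "cls (adj D N g) = k"
      by (intro unique) simp
    then show "L2norm (N g) = L2norm (adj D N g)"
      using A k N[OF gD] by (simp flip: norm_cls)
  qed
qed

section \<open>The semigroup \<open>Pt\<close>, its closure and its generator\<close>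

definition drift :: "real \<Rightarrow> real \<Rightarrow> complex" where
  "drift \<theta> t = exp (- cis \<theta> * complex_of_real t)"

lemma cmod_drift: "cmod (drift \<theta> t) = exp (- t * cos \<theta>)"
  by (simp add: drift_def mult.commute)

lemma drift_0: "drift \<theta> 0 = 1"
  by (simp add: drift_def)

lemma drift_add: "drift \<theta> (s + t) = drift \<theta> s * drift \<theta> t"
  by (simp add: drift_def exp_add[symmetric] algebra_simps)

text \<open>Hence the adjoint semigroup is the one for the angle \<open>- \<theta>\<close>, which
  has the same cosine.\<close>

lemma cnj_drift: "cnj (drift \<theta> t) = drift (- \<theta>) t"
  by (simp add: drift_def exp_cnj cis_cnj)

lemma Pt_eq_mehler: "Pt \<theta> t \<phi> = mehler (drift \<theta> t) \<phi>"
proof -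
  have "(cmod (drift \<theta> t))\<^sup>2 = exp (- 2 * t * cos \<theta>)"
    by (simp add: cmod_drift power2_eq_square exp_add[symmetric])
  then show ?thesis
    by (intro ext) (simp add: Pt_def mehler_def compl_def drift_def)
qed

lemma admissible_drift:
  assumes "cos \<theta> > 0" "t \<ge> 0"
  shows "admissible (drift \<theta> t)"
  using assms by (cases "t = 0") (auto simp: admissible_def drift_0 cmod_drift)

lemma OU_adjoint_semigroups:
  assumes "cos \<theta> > 0"
  shows "adjoint_semigroups (\<lambda>t. OU (drift \<theta> t)) (\<lambda>t. OU (drift (- \<theta>) t))"
proof (rule adjoint_semigroups.intro)
  have adm: "admissible (drift \<theta> t)" "admissible (drift (- \<theta>) t)" if "t \<ge> 0" for t
    using assms that by (auto intro: admissible_drift)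
  have tendsto: "((\<lambda>t. OU (drift \<eta> t) x) \<longlongrightarrow> x) (at_right 0)" if "cos \<eta> > 0" for \<eta> x
    unfolding tendsto_at_iff_sequentially
  proof (intro allI impI)
    fix X :: "nat \<Rightarrow> real" assume X: "\<forall>i. X i \<in> {0<..} - {0}" "X \<longlonglongrightarrow> 0"
    have "(\<lambda>n. drift \<eta> (X n)) \<longlonglongrightarrow> exp (- cis \<eta> * complex_of_real 0)"
      unfolding drift_def by (intro tendsto_intros X)
    then have "(\<lambda>n. drift \<eta> (X n)) \<longlonglongrightarrow> 1" by simp
    moreover have "admissible (drift \<eta> (X n))" for n
      using X(1) by (intro admissible_drift that) (auto simp: less_imp_le)
    ultimately show "((\<lambda>t. OU (drift \<eta> t) x) \<circ> X) \<longlonglongrightarrow> x"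
      unfolding o_def by (intro OU_tendsto)
  qed
  show "((\<lambda>t. OU (drift \<theta> t) x) \<longlongrightarrow> x) (at_right 0)" for x
    using assms by (rule tendsto)
  show "((\<lambda>t. OU (drift (- \<theta>) t) x) \<longlongrightarrow> x) (at_right 0)" for x
    using assms by (intro tendsto) simp
  show "inner (OU (drift \<theta> t) x) y = inner x (OU (drift (- \<theta>) t) y)" if "t \<ge> 0" for t x y
    using OU_adjoint[OF adm(1)[OF that]] by (simp add: cnj_drift)
  show "OU (drift \<theta> s) (OU (drift (- \<theta>) t) x) = OU (drift (- \<theta>) t) (OU (drift \<theta> s) x)"
    if "s \<ge> 0" "t \<ge> 0" for s t x
    using adm that by (simp add: OU_OU mult.commute)
qed (use assms in \<open>auto intro!: OU_linear OU_contraction admissible_drift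
       simp: drift_0 OU_1 drift_add OU_OU admissible_drift\<close>)

text \<open>The closure of a densely defined contraction is the graph of its continuous extension.
  Square integrability of \<open>g\<close> matters: for a measurable \<open>g\<close> without it the
  integral in \<open>L2norm\<close> defaults to 0, and the second convergence would hold
  trivially.\<close>

lemma Trel_iff:
  assumes adm: "admissible (drift \<theta> t)" and f: "L2 f" and g: "L2 g"
  shows "Trel \<theta> t f g \<longleftrightarrow> cls g = OU (drift \<theta> t) (cls f)"
proof -
  let ?T = "OU (drift \<theta> t)"
  have cont: "isCont ?T x" for x
    using OU_continuous[OF adm] by (simp add: continuous_on_eq_continuous_at)
  have lim_iff: "(\<lambda>n. L2norm (\<lambda>x. F n x - h x)) \<longlonglongrightarrow> 0 \<longleftrightarrow> (\<lambda>n. cls (F n)) \<longlonglongrightarrow> cls h"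
    if "\<And>n. L2 (F n)" "L2 h" for F h
    using that by (simp add: tendsto_norm_zero_iff LIM_zero_iff flip: norm_cls_diff)
  have "Trel \<theta> t f g \<longleftrightarrow>
      (\<exists>\<phi>. (\<forall>n. Cb (\<phi> n)) \<and> (\<lambda>n. cls (\<phi> n)) \<longlonglongrightarrow> cls f \<and> (\<lambda>n. ?T (cls (\<phi> n))) \<longlonglongrightarrow> cls g)"
    unfolding Trel_def Pt_eq_mehler
    by (intro ex_cong1 conj_cong refl)
       (simp_all add: lim_iff L2_Cb f g L2_mehler adm OU_cls)
  also have "\<dots> \<longleftrightarrow> cls g = ?T (cls f)"
  proof
    assume "\<exists>\<phi>. (\<forall>n. Cb (\<phi> n)) \<and> (\<lambda>n. cls (\<phi> n)) \<longlonglongrightarrow> cls f \<and> (\<lambda>n. ?T (cls (\<phi> n))) \<longlonglongrightarrow> cls g"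
    then show "cls g = ?T (cls f)"
      using isCont_tendsto_compose[OF cont] LIMSEQ_unique by blast
  next
    assume eq: "cls g = ?T (cls f)"
    have "cls f \<in> closure (cls ` Collect Cb)" by (simp add: cls_Cb_dense)
    then obtain X where X: "\<And>n. X n \<in> cls ` Collect Cb" "X \<longlonglongrightarrow> cls f"
      unfolding closure_sequential by blast
    then have "\<forall>n. \<exists>\<phi>. Cb \<phi> \<and> X n = cls \<phi>" by blast
    then obtain \<phi> where \<phi>: "\<And>n. Cb (\<phi> n)" "\<And>n. X n = cls (\<phi> n)" by metis
    have "X = (\<lambda>n. cls (\<phi> n))" using \<phi>(2) by auto
    then show "\<exists>\<phi>. (\<forall>n. Cb (\<phi> n)) \<and> (\<lambda>n. cls (\<phi> n)) \<longlonglongrightarrow> cls f \<and> (\<lambda>n. ?T (cls (\<phi> n))) \<longlonglongrightarrow> cls g"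
      using X(2) isCont_tendsto_compose[OF cont X(2)] \<phi>(1) unfolding eq
      by (intro exI[of _ \<phi>]) simp
  qed
  finally show ?thesis .
qed

lemma T2_cls:
  assumes adm: "admissible (drift \<theta> t)" and f: "L2 f"
  shows "L2 (T2 \<theta> t f) \<and> cls (T2 \<theta> t f) = OU (drift \<theta> t) (cls f)"
proof -
  obtain g where g: "L2 g" "cls g = OU (drift \<theta> t) (cls f)" by (metis ex_cls)
  then have "L2 g \<and> Trel \<theta> t f g" using Trel_iff[OF adm f] by simp
  then have "L2 (T2 \<theta> t f) \<and> Trel \<theta> t f (T2 \<theta> t f)"
    unfolding T2_def by (rule someI[where P = "\<lambda>g. L2 g \<and> Trel \<theta> t f g"])
  then show ?thesis using Trel_iff[OF adm f, of "T2 \<theta> t f"] by blast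
qed

text \<open>The limit from the right sees only \<open>s > 0\<close>, where the \<open>L2norm\<close>
  of the difference quotients of functions is the norm of those of classes.\<close>

lemma gen_lim_iff:
  assumes cos: "cos \<theta> > 0" and f: "L2 f"
  shows "gen_lim \<theta> f h \<longleftrightarrow> L2 h \<and>
    adjoint_semigroups.gen_to (\<lambda>t. OU (drift \<theta> t)) (cls f) (cls h)"
proof -
  interpret adjoint_semigroups "\<lambda>t. OU (drift \<theta> t)" "\<lambda>t. OU (drift (- \<theta>) t)"
    using cos by (rule OU_adjoint_semigroups)
  let ?q = "\<lambda>s. (OU (drift \<theta> s) (cls f) - cls f) /\<^sub>R s"
  have "((\<lambda>s. L2norm (\<lambda>x. (T2 \<theta> s f x - f x) / complex_of_real s - h x)) \<longlongrightarrow> 0) (at_right 0) \<longleftrightarrow>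
      gen_to (cls f) (cls h)" if h: "L2 h"
  proof -
    have "L2norm (\<lambda>x. (T2 \<theta> s f x - f x) / complex_of_real s - h x) = norm (?q s - cls h)" if "s > 0" for s
    proof -
      have T: "L2 (T2 \<theta> s f)" "cls (T2 \<theta> s f) = OU (drift \<theta> s) (cls f)"
        using T2_cls[OF admissible_drift[OF cos] f] that by auto
      have "L2norm (\<lambda>x. (T2 \<theta> s f x - f x) / complex_of_real s - h x) =
          L2norm (\<lambda>x. inverse s *\<^sub>R (T2 \<theta> s f x - f x) - h x)"
        by (rule arg_cong[where f = L2norm])
           (simp add: fun_eq_iff scaleR_conv_of_real divide_inverse mult.commute)
      also have "\<dots> = norm (cls (\<lambda>x. inverse s *\<^sub>R (T2 \<theta> s f x - f x)) - cls h)"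
        by (rule norm_cls_diff[symmetric]) (intro L2_scaleR L2_diff T f h)+
      finally show ?thesis
        using T f by (simp add: cls_scaleR cls_diff L2_diff)
    qed
    then have "\<forall>\<^sub>F s in at_right 0. L2norm (\<lambda>x. (T2 \<theta> s f x - f x) / complex_of_real s - h x) = norm (?q s - cls h)"
      using eventually_at_right_less[of "0::real"] by (auto elim: eventually_mono)
    then have "((\<lambda>s. L2norm (\<lambda>x. (T2 \<theta> s f x - f x) / complex_of_real s - h x)) \<longlongrightarrow> 0) (at_right 0) \<longleftrightarrow>
        ((\<lambda>s. norm (?q s - cls h)) \<longlongrightarrow> 0) (at_right 0)"
      by (rule filterlim_cong[OF refl refl])
    then show ?thesis
      by (simp add: gen_to_def tendsto_norm_zero_iff LIM_zero_iff)
  qed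
  then show ?thesis
    by (auto simp: gen_lim_def)
qed

text \<open>On the whole space closedness follows from continuity, and the adjoint vector of
  \<open>y\<close> is \<open>OU (drift (- \<theta>) t) y\<close>, of the right norm by
  \<open>norm_T_eq_norm_S\<close>.\<close>

lemma T2_normal:
  assumes cos: "cos \<theta> > 0" and t: "t \<ge> 0"
  shows "normal_op {f. L2 f} (T2 \<theta> t)"
proof -
  interpret adjoint_semigroups "\<lambda>t. OU (drift \<theta> t)" "\<lambda>t. OU (drift (- \<theta>) t)"
    using cos by (rule OU_adjoint_semigroups)
  have adm: "admissible (drift \<theta> t)"
    using cos t by (rule admissible_drift)
  show ?thesis
  proof (rule normal_opI[where D' = UNIV and N' = "OU (drift \<theta> t)"])
    show "L2 (T2 \<theta> t f) \<and> cls (T2 \<theta> t f) = OU (drift \<theta> t) (cls f)" if "f \<in> {f. L2 f}" for f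
      using T2_cls[OF adm] that by simp
    show "imul x \<in> UNIV \<and> OU (drift \<theta> t) (imul x) = imul (OU (drift \<theta> t) x)" for x
      using OU_imul[OF adm] by simp
    show "\<exists>y\<in>UNIV. norm (x - y) < e" if "e > 0" for x :: l2 and e
      using that by (intro bexI[of _ x]) auto
    show "x \<in> UNIV \<and> OU (drift \<theta> t) x = h"
      if "xs \<longlonglongrightarrow> x" "(\<lambda>n. OU (drift \<theta> t) (xs n)) \<longlonglongrightarrow> h" for xs x h
      using LIMSEQ_unique[OF bounded_linear.tendsto[OF bounded_linear_T[OF t] that(1)] that(2)] by simp
    show "\<exists>k. norm k = norm (OU (drift \<theta> t) y) \<and> (\<forall>x\<in>UNIV. inner (OU (drift \<theta> t) x) y = inner x k)" for y
      using norm_T_eq_norm_S[OF t] adjoint[OF t] by (intro exI[of _ "OU (drift (- \<theta>) t) y"]) simp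
  qed auto
qed

lemma gen_normal:
  assumes cos: "cos \<theta> > 0"
  shows "normal_op (gen_dom \<theta>) (gen \<theta>)"
proof -
  interpret adjoint_semigroups "\<lambda>t. OU (drift \<theta> t)" "\<lambda>t. OU (drift (- \<theta>) t)"
    using cos by (rule OU_adjoint_semigroups)
  interpret swap: adjoint_semigroups "\<lambda>t. OU (drift (- \<theta>) t)" "\<lambda>t. OU (drift \<theta> t)"
    by (rule swap)
  define D' where "D' = {x. \<exists>h. gen_to x h}"
  define A where "A x = (THE h. gen_to x h)" for x
  have A_eq: "A x = h" if "gen_to x h" for x h
    unfolding A_def using that gen_to_unique by blast
  have A: "gen_to x (A x)" if "x \<in> D'" for x
    using that A_eq by (auto simp: D'_def)
  have D: "f \<in> gen_dom \<theta> \<longleftrightarrow> L2 f \<and> cls f \<in> D'" for f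
  proof -
    have "\<exists>g. L2 g \<and> gen_to (cls f) (cls g)" if "gen_to (cls f) h" for h
      using that ex_cls[of h] by metis
    then show ?thesis
      using gen_lim_iff[OF cos] unfolding gen_dom_def D'_def by blast
  qed
  show ?thesis
  proof (rule normal_opI[where D' = D' and N' = A])
    show "f \<in> gen_dom \<theta> \<longleftrightarrow> L2 f \<and> cls f \<in> D'" for f by (rule D)
    show "L2 (gen \<theta> f) \<and> cls (gen \<theta> f) = A (cls f)" if "f \<in> gen_dom \<theta>" for f
    proof -
      from that have f: "L2 f" "\<exists>h. gen_lim \<theta> f h" by (auto simp: gen_dom_def)
      from someI_ex[OF f(2)] have "gen_lim \<theta> f (gen \<theta> f)" by (simp add: gen_def)
      then show ?thesis using A_eq[of "cls f" "cls (gen \<theta> f)"] by (auto simp: gen_lim_iff[OF cos f(1)])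
    qed
    show "imul x \<in> D' \<and> A (imul x) = imul (A x)" if x: "x \<in> D'" for x
    proof -
      interpret i: bounded_linear imul by (rule bounded_linear_imul)
      \<comment> \<open>The difference quotients commute with multiplication by \<open>\<i>\<close>,
        and therefore so does their limit.\<close>
      have "((\<lambda>s. imul ((OU (drift \<theta> s) x - x) /\<^sub>R s)) \<longlongrightarrow> imul (A x)) (at_right 0)"
        using A[OF x] unfolding gen_to_def by (rule i.tendsto)
      moreover have "\<forall>\<^sub>F s in at_right 0. imul ((OU (drift \<theta> s) x - x) /\<^sub>R s) =
          (OU (drift \<theta> s) (imul x) - imul x) /\<^sub>R s"
        using eventually_at_right_less
        by eventually_elim (simp add: i.scaleR i.diff OU_imul admissible_drift[OF cos])
      ultimately have "gen_to (imul x) (imul (A x))"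
        unfolding gen_to_def by (rule Lim_transform_eventually)
      then show ?thesis using A_eq by (auto simp: D'_def)
    qed
    show "\<exists>y\<in>D'. norm (x - y) < e" if "e > 0" for x e
      using gen_dom_dense[OF that, of x] by (auto simp: D'_def)
    show "x \<in> D' \<and> A x = h" if "\<And>n. xs n \<in> D'" "xs \<longlonglongrightarrow> x" "(\<lambda>n. A (xs n)) \<longlonglongrightarrow> h" for xs x h
      using gen_to_closed[OF A[OF that(1)] that(2,3)] A_eq by (auto simp: D'_def)
    show "\<exists>k. norm k = norm (A y) \<and> (\<forall>x\<in>D'. inner (A x) y = inner x k)" if y: "y \<in> D'" for y
    proof -
      obtain k where k: "swap.gen_to y k" "norm k = norm (A y)"
        using gen_to_imp_adjoint_gen_to[OF A[OF y]] .
      then show ?thesis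
        using gen_to_adjoint[OF A] by blast
    qed
    show "y \<in> D'" if "\<And>x. x \<in> D' \<Longrightarrow> inner (A x) y = inner x k" for y k
    proof -
      have "inner h y = inner x k" if "gen_to x h" for x h
        using \<open>\<And>x. x \<in> D' \<Longrightarrow> inner (A x) y = inner x k\<close>[of x] A_eq[OF that] that
        by (auto simp: D'_def)
      then have "swap.gen_to y k"
        by (rule gen_adjoint_imp_gen_to)
      \<comment> \<open>A vector in the domain of the adjoint lies in the domain of the generator of
        the adjoint semigroup, and the simultaneous convergence, read from \<open>S\<close> to
        \<open>T\<close>, puts it in the domain of the original generator.\<close>
      then obtain h where "gen_to y h"
        by (rule swap.gen_to_imp_adjoint_gen_to)
      then show ?thesis by (auto simp: D'_def)
    qed
  qed
qed

theorem theorem3p4: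
  fixes \<theta> :: real
  assumes "- (pi / 2) < \<theta>" and "\<theta> < pi / 2"
  shows "(\<forall>t\<ge>0. normal_op {f. L2 f} (T2 \<theta> t)) \<and> normal_op (gen_dom \<theta>) (gen \<theta>)"
  using T2_normal gen_normal cos_gt_zero_pi[OF assms] by blast

end
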